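(* Let $(X,\Sigma,\nu)$ be an arbitrary normalized measure space (i.e. $\nu(X)=1$). Let $y\in L_1(X)$ be real-valued and let $\Omega(y)$ be the set of all real-valued integrable functions on $(X,\Sigma,\nu)$ majorised by $y$ in the sense of Hardy--Littlewood--Pólya. Let $x\in\Omega(y)$. Then $x$ is an extreme point of $\Omega(y)$ if and only if for each $t\in(0,1)$ one of the following holds: (1) $\lambda(t;x)=\lambda(t;y)$; (2) $\lambda(t;x)\neq\lambda(t;y)$, the preimage $x^{-1}(\lambda(t;x))$ is an atom in $(X,\Sigma,\nu)$, and $$\int_{\{s\,:\,\lambda(s;x)=\lambda(t;x)\}}\lambda(s;y)\,ds=\lambda(t;x)\,\nu\big(x^{-1}(\lambda(t;x))\big).$$
   Context: Functions are identified when they agree $\nu$-a.e. For a real-valued integrable function $f$ on $(X,\Sigma,\nu)$, $\lambda(f)$ is its right-continuous equimeasurable non-increasing rearrangement: $\lambda(t;f)=\inf\{s\in\mathbb{R}:\nu(\{f>s\})\le t\}$, $t\in[0,1)$. For $f,g\in L_1(X)$ real-valued, $g$ is majorised by $f$ in the sense of Hardy--Littlewood--Pólya, written $g\prec f$, if $\int_0^s\lambda(t;g)\,dt\le\int_0^s\lambda(t;f)\,dt$ for all $s\in[0,1)$ and $\int_0^1\lambda(t;g)\,dt=\int_0^1\lambda(t;f)\,dt$. An atom in $(X,\Sigma,\nu)$ is a set $A\in\Sigma$ with $\nu(A)>0$ such that every measurable $B\subset A$ satisfies $\nu(B)=0$ or $\nu(B)=\nu(A)$. *)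

theory Defs
  imports "HOL-Probability.Probability"
begin

text \<open>
  Right-continuous non-increasing rearrangement of an integrable function on a probability space,
  meant for arguments in the interval from 0 (included) to 1 (excluded). At 0 the set below is empty
  if the function is essentially unbounded above; the mathematical value is then infinite while
  the real-valued infimum is unspecified. This is harmless: all other points of the interval give
  a nonempty set that is bounded below, and the point 0 is Lebesgue-null.
\<close>

definition rearrangement :: "'a measure \<Rightarrow> ('a \<Rightarrow> real) \<Rightarrow> real \<Rightarrow> real" where
  "rearrangement M f t = Inf {s. measure M {\<omega> \<in> space M. f \<omega> > s} \<le> t}"

definition majorised_by :: "'a measure \<Rightarrow> ('a \<Rightarrow> real) \<Rightarrow> ('a \<Rightarrow> real) \<Rightarrow> bool" where
  "majorised_by M g f \<longleftrightarrow>
     (\<forall>s\<in>{0..<1}. (LBINT t=0..ereal s. rearrangement M g t)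
                   \<le> (LBINT t=0..ereal s. rearrangement M f t)) \<and>
     (LBINT t=0..1. rearrangement M g t) = (LBINT t=0..1. rearrangement M f t)"

definition Omega :: "'a measure \<Rightarrow> ('a \<Rightarrow> real) \<Rightarrow> ('a \<Rightarrow> real) set" where
  "Omega M y = {g. integrable M g \<and> majorised_by M g y}"

text \<open>
  Elements of the space of integrable functions are classes modulo almost-everywhere equality. This
  is \<open>extreme_point_of\<close> for representatives, with both equalities (membership in the open
  segment, and distinctness of its endpoints) read almost everywhere.
\<close>

definition ae_extreme_point_of ::
    "'a measure \<Rightarrow> ('a \<Rightarrow> real) \<Rightarrow> ('a \<Rightarrow> real) set \<Rightarrow> bool" where
  "ae_extreme_point_of M x S \<longleftrightarrow>
     x \<in> S \<and>
     (\<forall>a\<in>S. \<forall>b\<in>S. \<not> (\<not> (AE \<omega> in M. a \<omega> = b \<omega>) \<and>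
        (\<exists>u. 0 < u \<and> u < 1 \<and> (AE \<omega> in M. x \<omega> = (1 - u) * a \<omega> + u * b \<omega>))))"

definition measure_atom :: "'a measure \<Rightarrow> 'a set \<Rightarrow> bool" where
  "measure_atom M A \<longleftrightarrow>
     A \<in> sets M \<and> emeasure M A > 0 \<and>
     (\<forall>B\<in>sets M. B \<subseteq> A \<longrightarrow> emeasure M B = 0 \<or> emeasure M B = emeasure M A)"

end

theory Submission
  imports Defs
begin

text \<open>
  Write \<open>\<lambda>\<^sub>f\<close> for the rearrangement of \<open>f\<close>, \<open>F\<^sub>f(r)\<close> for the integral of \<open>\<lambda>\<^sub>f\<close> over \<open>(0,r)\<close>, and
  \<open>\<Phi>\<^sub>f(s)\<close> for the integral of the positive part of \<open>f - s\<close>. Since \<open>\<lambda>\<^sub>f\<close> and \<open>f\<close> are equidistributed,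
  \<open>\<Phi>\<^sub>f\<close> is the Legendre transform of the concave function \<open>F\<^sub>f\<close>: the number \<open>F\<^sub>f(r) - s r\<close> is at most
  \<open>\<Phi>\<^sub>f(s)\<close>, with equality when \<open>r\<close> lies between the measures of \<open>{f > s}\<close> and \<open>{f \<ge> s}\<close>. Hence \<open>g\<close> is
  majorised by \<open>f\<close> exactly when their integrals agree and \<open>\<Phi>\<^sub>g \<le> \<Phi>\<^sub>f\<close> (\<open>majorised_by_iff_stop_loss\<close>).
  The gain is that \<open>\<Phi>\<^sub>f\<close> is convex in \<open>f\<close> and reacts only locally to a change of the values of \<open>f\<close>.
  The proof compares \<open>\<Phi>\<^sub>x\<close> with \<open>\<Phi>\<^sub>y\<close>; call \<open>s\<close> a contact point if they agree at \<open>s\<close>.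

  Let \<open>x\<close> be extreme. If an interval \<open>[p,q]\<close> has no contact point and \<open>{p \<le> x \<le> q}\<close> contained two
  disjoint sets of positive measure, then raising \<open>x\<close> a little on one and lowering it on the other,
  and the reverse, would stay below \<open>\<Phi>\<^sub>y\<close> and exhibit \<open>x\<close> as a midpoint
  (\<open>extreme_point_indecomposable\<close>). A value \<open>c = \<lambda>\<^sub>x(t) \<noteq> \<lambda>\<^sub>y(t)\<close> is not a contact point, so \<open>{x = c}\<close> is
  an atom and \<open>x\<close> takes almost no other value between the contact points next to \<open>c\<close>. Duality at these
  two points gives \<open>F\<^sub>x = F\<^sub>y\<close> at both ends of the level interval of \<open>c\<close>, which is the integral
  condition. (On a side without contact points \<open>x\<close> takes almost no values, and the end is 0 or 1.)

  Conversely, the condition makes \<open>\<lambda>\<^sub>y - \<lambda>\<^sub>x\<close> integrate to zero over every level interval of \<open>\<lambda>\<^sub>x\<close>, so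
  \<open>F\<^sub>x = F\<^sub>y\<close> at the ends of all of them. Suppose \<open>x\<close> lies properly between \<open>a\<close> and \<open>b\<close>, both majorised by
  \<open>y\<close>. Equality in the convexity of \<open>\<Phi>\<close> shows that at a contact point \<open>s\<close> the values of \<open>a\<close> and \<open>b\<close> are
  almost surely on the same side of \<open>s\<close> (\<open>segment_same_side\<close>). If \<open>a < p < b\<close> with positive
  probability, then \<open>p\<close> is no contact point; contact points on either side of \<open>p\<close> confine \<open>x\<close> to one
  level \<open>c\<close> on this event, which must then fill the atom \<open>{x = c}\<close>. But the Hardy-Littlewood inequality
  forces \<open>a\<close> and \<open>b\<close> to have the same integral over that atom (\<open>segment_no_crossing\<close>).
\<close>

section \<open>Integrals of the rearrangement and the stop-loss transform\<close>

abbreviation unit_lborel :: "real measure" where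
  "unit_lborel \<equiv> restrict_space lborel {0<..<1}"

text \<open>
  Integrals run over \<^term>\<open>unit_lborel\<close> with an indicator, so that one space carries all
  rearrangements and the point 0, where their value may be arbitrary, is excluded.
\<close>

definition head_integral :: "'a measure \<Rightarrow> ('a \<Rightarrow> real) \<Rightarrow> real \<Rightarrow> real" where
  "head_integral M f r = (LINT t|unit_lborel. indicator {..<r} t * rearrangement M f t)"

text \<open>
  The name is that of actuarial mathematics, where the pointwise order of these transforms is the
  stop-loss order. It is the Legendre transform of \<^const>\<open>head_integral\<close>.
\<close>

definition stop_loss :: "'a measure \<Rightarrow> ('a \<Rightarrow> real) \<Rightarrow> real \<Rightarrow> real" where
  "stop_loss M f s = (LINT \<omega>|M. max 0 (f \<omega> - s))"

interpretation unit_lborel: prob_space unit_lborel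
  by (auto simp: emeasure_restrict_space space_restrict_space intro!: prob_spaceI)

lemma measure_unit_lborel_lessThan:
  assumes "0 \<le> r" "r \<le> 1"
  shows "measure unit_lborel ({..<r} \<inter> {0<..<1}) = r"
proof -
  have "{..<r} \<inter> {0<..<1} = {0<..<r}" using assms by auto
  moreover have "measure unit_lborel {0<..<r} = measure lborel {0<..<r}"
    using assms by (intro measure_restrict_space) auto
  ultimately show ?thesis using assms by simp
qed

lemma interval_integral_eq_unit_lborel:
  fixes g :: "real \<Rightarrow> real"
  assumes "0 \<le> r" "r \<le> 1"
  shows "(LBINT t=0..ereal r. g t) = (LINT t|unit_lborel. indicator {..<r} t * g t)"
proof -
  have "(LBINT t=0..ereal r. g t) = (LBINT t:{0<..<r}. g t)"
    using assms by (auto simp: interval_lebesgue_integral_def zero_ereal_def)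
  also have "\<dots> = (LBINT t. indicator {0<..<1} t *\<^sub>R (indicator {..<r} t * g t))"
    unfolding set_lebesgue_integral_def using assms
    by (intro Bochner_Integration.integral_cong) (auto simp: indicator_def)
  also have "\<dots> = (LINT t|unit_lborel. indicator {..<r} t * g t)"
    by (subst integral_restrict_space) auto
  finally show ?thesis .
qed

lemma majorised_by_iff_head_integral:
  "majorised_by M g f \<longleftrightarrow>
     (\<forall>r\<in>{0..<1}. head_integral M g r \<le> head_integral M f r) \<and>
     head_integral M g 1 = head_integral M f 1"
  using interval_integral_eq_unit_lborel[of _ "rearrangement M f"]
    interval_integral_eq_unit_lborel[of _ "rearrangement M g"]
  unfolding majorised_by_def head_integral_def
  by (simp add: one_ereal_def)

section \<open>The rearrangement as an equidistributed function on the unit interval\<close>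

context prob_space begin

lemma cdf_distr_eq_tail:
  assumes f: "f \<in> borel_measurable M"
  shows "cdf (distr M borel f) s = 1 - prob {\<omega>\<in>space M. f \<omega> > s}"
proof -
  have "cdf (distr M borel f) s = prob {\<omega>\<in>space M. f \<omega> \<le> s}"
    using f by (simp add: cdf_def measure_distr vimage_def Int_def conj_commute)
  also have "\<dots> = 1 - prob {\<omega>\<in>space M. \<not> f \<omega> \<le> s}"
    using f by (subst prob_neg) auto
  finally show ?thesis by (simp add: not_le)
qed

text \<open>
  The infimum in the definition is the quantile of \<open>f\<close> at \<open>1 - t\<close>, so this Galois connection is the one
  between a distribution function and its pseudo-inverse. All pointwise knowledge about the
  rearrangement comes from it.
\<close>

lemma rearrangement_le_iff:
  assumes f: "f \<in> borel_measurable M" and t: "0 < t" "t < 1"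
  shows "rearrangement M f t \<le> s \<longleftrightarrow> prob {\<omega>\<in>space M. f \<omega> > s} \<le> t"
proof -
  interpret D: real_distribution "distr M borel f"
    using f by (simp add: real_distribution_distr)
  interpret D: cdf_distribution "distr M borel f" ..
  have "{s. prob {\<omega>\<in>space M. f \<omega> > s} \<le> t} = {s. 1 - t \<le> cdf (distr M borel f) s}"
    by (auto simp: cdf_distr_eq_tail[OF f])
  then have "rearrangement M f t = D.I (1 - t)" by (simp add: rearrangement_def)
  then show ?thesis
    using D.pseudoinverse[of "1 - t" s] t by (simp add: cdf_distr_eq_tail[OF f])
qed

lemma less_rearrangement_iff:
  assumes "f \<in> borel_measurable M" "0 < t" "t < 1"
  shows "s < rearrangement M f t \<longleftrightarrow> t < prob {\<omega>\<in>space M. f \<omega> > s}"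
  using rearrangement_le_iff[OF assms] by (auto simp: not_le[symmetric])

lemma rearrangement_antimono:
  assumes "f \<in> borel_measurable M" "0 < s" "s \<le> t" "t < 1"
  shows "rearrangement M f t \<le> rearrangement M f s"
  using rearrangement_le_iff[OF assms(1), of t "rearrangement M f s"]
    rearrangement_le_iff[OF assms(1), of s "rearrangement M f s"] assms by auto

lemma rearrangement_superlevel:
  assumes f: "f \<in> borel_measurable M"
  shows "{t \<in> space unit_lborel. s < rearrangement M f t}
    = {..<prob {\<omega>\<in>space M. f \<omega> > s}} \<inter> {0<..<1}"
  using less_rearrangement_iff[OF f] by (auto simp: space_restrict_space)

lemma rearrangement_measurable:
  assumes f: "f \<in> borel_measurable M"
  shows "rearrangement M f \<in> borel_measurable unit_lborel"
  by (rule borel_measurableI_greater, subst rearrangement_superlevel[OF f])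
    (simp add: sets_restrict_space_iff)

lemma distr_rearrangement:
  assumes f: "f \<in> borel_measurable M"
  shows "distr unit_lborel borel (rearrangement M f) = distr M borel f"
proof (rule cdf_unique)
  note [measurable] = f rearrangement_measurable[OF f]
  show "real_distribution (distr unit_lborel borel (rearrangement M f))"
    by (simp add: unit_lborel.real_distribution_distr)
  show "real_distribution (distr M borel f)" by (simp add: real_distribution_distr)
  show "cdf (distr unit_lborel borel (rearrangement M f)) = cdf (distr M borel f)"
    unfolding fun_eq_iff
      cdf_distr_eq_tail[OF f]
      prob_space.cdf_distr_eq_tail[OF unit_lborel.prob_space_axioms rearrangement_measurable[OF f]]
      rearrangement_superlevel[OF f]
    by (simp add: measure_unit_lborel_lessThan)
qed

lemma integral_rearrangement:
  fixes h :: "real \<Rightarrow> real"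
  assumes f: "f \<in> borel_measurable M" and [measurable]: "h \<in> borel_measurable borel"
  shows "(LINT t|unit_lborel. h (rearrangement M f t)) = (LINT \<omega>|M. h (f \<omega>))"
proof -
  note [measurable] = f rearrangement_measurable[OF f]
  have "(LINT t|unit_lborel. h (rearrangement M f t))
      = (LINT v|distr unit_lborel borel (rearrangement M f). h v)"
    by (simp add: integral_distr)
  also have "\<dots> = (LINT v|distr M borel f. h v)" by (simp only: distr_rearrangement[OF f])
  also have "\<dots> = (LINT \<omega>|M. h (f \<omega>))" by (simp add: integral_distr)
  finally show ?thesis .
qed

lemma integrable_rearrangement:
  assumes f: "integrable M f"
  shows "integrable unit_lborel (rearrangement M f)"
proof -
  note [measurable] = borel_measurable_integrable[OF f]
  note [measurable] = rearrangement_measurable[OF borel_measurable_integrable[OF f]]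
  have "integrable (distr M borel f) (\<lambda>v. v)"
    using f by (subst integrable_distr_eq) auto
  then have "integrable (distr unit_lborel borel (rearrangement M f)) (\<lambda>v. v)"
    by (simp only: distr_rearrangement[OF borel_measurable_integrable[OF f]])
  from integrable_distr[OF _ this] show ?thesis by simp
qed

text \<open>
  Together with \<open>rearrangement_less\<close> below this locates the weak superlevel sets. At
  \<open>t\<close> equal to the measure of \<open>{f \<ge> s}\<close> both orders can occur.
\<close>

lemma le_rearrangement:
  assumes f: "f \<in> borel_measurable M" and t: "0 < t" "t < prob {\<omega>\<in>space M. f \<omega> \<ge> s}"
  shows "s \<le> rearrangement M f t"
proof (rule dense_ge)
  fix s'
  note [measurable] = f
  have t1: "t < 1" using t(2) prob_le_1 less_le_trans by blast
  assume "rearrangement M f t < s'"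
  show "s \<le> s'"
  proof (rule ccontr)
    assume "\<not> s \<le> s'"
    then have "prob {\<omega>\<in>space M. f \<omega> \<ge> s} \<le> prob {\<omega>\<in>space M. f \<omega> > s'}"
      by (intro finite_measure_mono) auto
    then show False
      using less_rearrangement_iff[OF f t(1) t1, of s'] t \<open>rearrangement M f t < s'\<close> by auto
  qed
qed

lemma AE_rearrangement_greater_iff:
  assumes f: "f \<in> borel_measurable M"
  shows "AE t in unit_lborel. s < rearrangement M f t \<longleftrightarrow> t < prob {\<omega>\<in>space M. f \<omega> > s}"
  using less_rearrangement_iff[OF f] by (intro AE_I2) (auto simp: space_restrict_space)

text \<open>
  Otherwise the antitone rearrangement would be at least \<open>s\<close> on all of \<open>(0,t)\<close>, a set larger than
  equidistribution allows.
\<close>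

lemma rearrangement_less:
  assumes f: "f \<in> borel_measurable M" and t: "prob {\<omega>\<in>space M. f \<omega> \<ge> s} < t" "t < 1"
  shows "rearrangement M f t < s"
proof (rule ccontr)
  note [measurable] = f rearrangement_measurable[OF f]
  assume n: "\<not> rearrangement M f t < s"
  have t0: "0 < t" using t(1) measure_nonneg le_less_trans by blast
  have "measure unit_lborel {u\<in>space unit_lborel. rearrangement M f u \<ge> s}
      = measure (distr unit_lborel borel (rearrangement M f)) {s..}"
    by (simp add: measure_distr vimage_def Int_def conj_commute)
  also have "\<dots> = prob {\<omega>\<in>space M. f \<omega> \<ge> s}"
    unfolding distr_rearrangement[OF f]
    by (simp add: measure_distr vimage_def Int_def conj_commute)
  finally have eq: "measure unit_lborel {u\<in>space unit_lborel. rearrangement M f u \<ge> s}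
      = prob {\<omega>\<in>space M. f \<omega> \<ge> s}" .
  have "{..<t} \<inter> {0<..<1} \<subseteq> {u\<in>space unit_lborel. rearrangement M f u \<ge> s}"
  proof
    fix u assume "u \<in> {..<t} \<inter> {0<..<1}"
    then show "u \<in> {u\<in>space unit_lborel. rearrangement M f u \<ge> s}"
      using n rearrangement_antimono[OF f, of u t] t by (auto simp: space_restrict_space)
  qed
  then have "measure unit_lborel ({..<t} \<inter> {0<..<1}) \<le> prob {\<omega>\<in>space M. f \<omega> \<ge> s}"
    unfolding eq[symmetric] by (rule unit_lborel.finite_measure_mono) measurable
  then show False using t t0 measure_unit_lborel_lessThan[of t] by simp
qed

lemma AE_rearrangement_ge_iff:
  assumes f: "f \<in> borel_measurable M"
  shows "AE t in unit_lborel. s \<le> rearrangement M f t \<longleftrightarrow> t < prob {\<omega>\<in>space M. f \<omega> \<ge> s}"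
proof -
  let ?r = "prob {\<omega>\<in>space M. f \<omega> \<ge> s}"
  have "AE t in lborel. t \<noteq> ?r" by (rule AE_lborel_singleton)
  then have "AE t in unit_lborel. t \<noteq> ?r"
    by (subst AE_restrict_space_iff) auto
  with AE_space show ?thesis
  proof eventually_elim
    case (elim t)
    then show ?case
      using le_rearrangement[OF f, of t s] rearrangement_less[OF f, of s t]
      by (cases "t < ?r") (auto simp: space_restrict_space)
  qed
qed

section \<open>Duality between head integrals and the stop-loss transform\<close>

lemma head_integral_0: "head_integral M f 0 = 0"
proof -
  have "(LINT t|unit_lborel. indicator {..<0} t * rearrangement M f t) = (LINT t|unit_lborel. 0)"
    by (intro Bochner_Integration.integral_cong) (auto simp: space_restrict_space)
  then show ?thesis by (simp add: head_integral_def)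
qed

lemma head_integral_1:
  assumes "integrable M f"
  shows "head_integral M f 1 = (LINT \<omega>|M. f \<omega>)"
proof -
  have "head_integral M f 1 = (LINT t|unit_lborel. rearrangement M f t)"
    unfolding head_integral_def
    by (intro Bochner_Integration.integral_cong) (auto simp: space_restrict_space)
  also have "\<dots> = (LINT \<omega>|M. f \<omega>)"
    by (rule integral_rearrangement) (use assms in auto)
  finally show ?thesis .
qed

lemma integrable_indicator_rearrangement:
  assumes "integrable M f" "A \<in> sets borel"
  shows "integrable unit_lborel (\<lambda>t. indicator A t * (rearrangement M f t - s))"
proof -
  have "integrable unit_lborel (\<lambda>t. (rearrangement M f t - s) * indicator (A \<inter> space unit_lborel) t)"
    using assms integrable_rearrangement[of f]
    by (intro integrable_real_mult_indicator) (auto simp: sets_restrict_space)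
  also have "integrable unit_lborel
      (\<lambda>t. (rearrangement M f t - s) * indicator (A \<inter> space unit_lborel) t) \<longleftrightarrow> ?thesis"
    by (intro Bochner_Integration.integrable_cong) (auto simp: space_restrict_space indicator_def)
  finally show ?thesis .
qed

lemma head_integral_diff_eq:
  assumes f: "integrable M f" and r: "0 \<le> r" "r \<le> 1"
  shows "head_integral M f r - s * r
    = (LINT t|unit_lborel. indicator {..<r} t * (rearrangement M f t - s))"
proof -
  have i: "integrable unit_lborel (\<lambda>t. indicator {..<r} t * rearrangement M f t)"
    using integrable_indicator_rearrangement[OF f, of "{..<r}" 0] by simp
  have j: "integrable unit_lborel (\<lambda>t. indicator ({..<r} \<inter> {0<..<1}) t :: real)"
    by (intro integrable_real_indicator)
      (auto simp: sets_restrict_space unit_lborel.emeasure_eq_measure)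
  have "(LINT t|unit_lborel. indicator {..<r} t * (rearrangement M f t - s))
    = (LINT t|unit_lborel. indicator {..<r} t * rearrangement M f t
         - s * indicator ({..<r} \<inter> {0<..<1}) t)"
    by (intro Bochner_Integration.integral_cong) (auto simp: space_restrict_space indicator_def)
  also have "\<dots> = head_integral M f r - s * r"
    using i j measure_unit_lborel_lessThan[OF r]
    by (simp add: head_integral_def space_restrict_space Int_assoc)
  finally show ?thesis by simp
qed

lemma integrable_stop_loss:
  fixes f :: "'a \<Rightarrow> real"
  shows   "integrable M f \<Longrightarrow> integrable M (\<lambda>\<omega>. max 0 (f \<omega> - s))"
  by (auto intro!: Bochner_Integration.integrable_max)

lemma stop_loss_eq_rearrangement:
  assumes "integrable M f"
  shows "stop_loss M f s = (LINT t|unit_lborel. max 0 (rearrangement M f t - s))"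
  unfolding stop_loss_def using assms
  by (subst integral_rearrangement[of f "\<lambda>v. max 0 (v - s)"]) auto

lemma integrable_stop_loss_rearrangement:
  assumes "integrable M f"
  shows "integrable unit_lborel (\<lambda>t. max 0 (rearrangement M f t - s))"
  using integrable_rearrangement[OF assms] by (auto intro!: Bochner_Integration.integrable_max)

text \<open>
  The positive part of \<open>\<lambda>\<^sub>f - s\<close> dominates \<open>\<lambda>\<^sub>f - s\<close> restricted to \<open>(0,r)\<close>; the cases of equality follow.
\<close>

lemma head_integral_le_stop_loss:
  assumes f: "integrable M f" and r: "0 \<le> r" "r \<le> 1"
  shows "head_integral M f r - s * r \<le> stop_loss M f s"
  unfolding head_integral_diff_eq[OF f r] stop_loss_eq_rearrangement[OF f]
  by (intro integral_mono integrable_indicator_rearrangement f integrable_stop_loss_rearrangement)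
     (auto simp: indicator_def)

lemma head_integral_eq_stop_lossI:
  assumes f: "integrable M f" and r: "0 \<le> r" "r \<le> 1"
    and ge: "\<And>t. 0 < t \<Longrightarrow> t < r \<Longrightarrow> s \<le> rearrangement M f t"
    and le: "\<And>t. r < t \<Longrightarrow> t < 1 \<Longrightarrow> rearrangement M f t \<le> s"
  shows "head_integral M f r - s * r = stop_loss M f s"
proof -
  note [measurable] = rearrangement_measurable[OF borel_measurable_integrable[OF f]]
  have "AE t in lborel. t \<noteq> r" by (rule AE_lborel_singleton)
  then have ne: "AE t in unit_lborel. t \<noteq> r"
    by (subst AE_restrict_space_iff) auto
  have "AE t in unit_lborel. indicator {..<r} t * (rearrangement M f t - s)
       = max 0 (rearrangement M f t - s)"
    using ne AE_space
    by eventually_elim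
      (use ge le r in \<open>force simp: space_restrict_space indicator_def max_def\<close>)
  then show ?thesis
    unfolding head_integral_diff_eq[OF f r] stop_loss_eq_rearrangement[OF f]
    using integrable_indicator_rearrangement[OF f, of "{..<r}" s]
    by (intro integral_cong_AE) auto
qed

lemma head_integral_eq_stop_loss_rearrangement:
  assumes f: "integrable M f" and r: "0 < r" "r < 1"
  shows "head_integral M f r - rearrangement M f r * r = stop_loss M f (rearrangement M f r)"
  using r rearrangement_antimono[OF borel_measurable_integrable[OF f]]
  by (intro head_integral_eq_stop_lossI f) auto

lemma head_integral_eq_stop_loss_level:
  assumes f: "integrable M f"
    and r: "prob {\<omega>\<in>space M. f \<omega> > s} \<le> r" "r \<le> prob {\<omega>\<in>space M. f \<omega> \<ge> s}"
  shows "head_integral M f r - s * r = stop_loss M f s"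
proof (rule head_integral_eq_stop_lossI[OF f])
  note [measurable] = borel_measurable_integrable[OF f]
  show "0 \<le> r" using r(1) measure_nonneg order_trans by blast
  then show "rearrangement M f t \<le> s" if "r < t" "t < 1" for t
    using that r rearrangement_le_iff[of f t s] by auto
  show "r \<le> 1" using r(2) prob_le_1 order_trans by blast
  show "s \<le> rearrangement M f t" if "0 < t" "t < r" for t
    using le_rearrangement[of f t s] that r by auto
qed

lemma prob_greater_le_ge:
  fixes f :: "'a \<Rightarrow> real"
  assumes "f \<in> borel_measurable M"
  shows "prob {\<omega>\<in>space M. f \<omega> > s} \<le> prob {\<omega>\<in>space M. f \<omega> \<ge> s}"
  using assms by (intro finite_measure_mono) auto

text \<open>
  The level set of the statement may contain the point 0, where the rearrangement may be arbitrary; it is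
  null, so dropping it changes nothing.
\<close>

lemma level_integral_eq_unit_lborel:
  fixes g :: "real \<Rightarrow> real"
  assumes f: "f \<in> borel_measurable M" and g: "g \<in> borel_measurable unit_lborel"
  shows "(LBINT s:{s\<in>{0..<1}. rearrangement M f s = c}. g s)
    = (LINT t|unit_lborel. indicator {c} (rearrangement M f t) * g t)"
proof -
  note [measurable] = rearrangement_measurable[OF f] g
  let ?A = "{s\<in>{0..<1}. rearrangement M f s = c}"
  let ?h = "\<lambda>t. indicator {0<..<1} t * (indicator {c} (rearrangement M f t) * g t)"
  let ?k = "\<lambda>t. indicator ?A t * g t"
  have h: "?h \<in> borel_measurable lborel"
  proof -
    have "(\<lambda>t. indicator {c} (rearrangement M f t) * g t) \<in> borel_measurable unit_lborel"
      by measurable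
    then show ?thesis by (subst (asm) borel_measurable_restrict_space_iff) auto
  qed
  have eq: "?k = (\<lambda>t. ?h t + indicator {0} t * ?k 0)"
    by (auto simp: indicator_def fun_eq_iff)
  have k: "?k \<in> borel_measurable lborel"
    by (subst eq, intro borel_measurable_add h borel_measurable_times) auto
  have "(LBINT s:?A. g s) = (LBINT t. ?k t)"
    by (simp add: set_lebesgue_integral_def)
  also have "\<dots> = (LBINT t. ?h t)"
  proof (rule integral_cong_AE[OF k h])
    show "AE t in lborel. ?k t = ?h t"
      using AE_lborel_singleton[of 0] by eventually_elim (auto simp: indicator_def)
  qed
  also have "\<dots> = (LINT t|unit_lborel. indicator {c} (rearrangement M f t) * g t)"
    by (subst integral_restrict_space) auto
  finally show ?thesis .
qed

text \<open>
  Up to its two end points, the level set of \<open>\<lambda>\<^sub>x\<close> at \<open>c\<close> is the interval from the measure of \<open>{x > c}\<close>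
  to the measure of \<open>{x \<ge> c}\<close>.
\<close>

lemma level_integral_eq_head_integral:
  assumes x: "integrable M x" and y: "integrable M y"
  shows "(LBINT s:{s\<in>{0..<1}. rearrangement M x s = c}. rearrangement M y s)
    = head_integral M y (prob {\<omega>\<in>space M. x \<omega> \<ge> c})
      - head_integral M y (prob {\<omega>\<in>space M. x \<omega> > c})"
proof -
  have xm: "x \<in> borel_measurable M" and ym: "y \<in> borel_measurable M" using x y by auto
  note [measurable] = rearrangement_measurable[OF xm] rearrangement_measurable[OF ym]
  let ?a = "prob {\<omega>\<in>space M. x \<omega> > c}" and ?b = "prob {\<omega>\<in>space M. x \<omega> \<ge> c}"
  have i: "integrable unit_lborel (\<lambda>t. indicator {..<r} t * rearrangement M y t)" for r
    using integrable_indicator_rearrangement[OF y, of "{..<r}" 0] by simp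
  have "AE t in unit_lborel. indicator {c} (rearrangement M x t) * rearrangement M y t
      = indicator {..<?b} t * rearrangement M y t - indicator {..<?a} t * rearrangement M y t"
    using AE_rearrangement_greater_iff[OF xm, of c] AE_rearrangement_ge_iff[OF xm, of c]
    by eventually_elim (auto simp: indicator_def)
  then have "(LINT t|unit_lborel. indicator {c} (rearrangement M x t) * rearrangement M y t)
      = (LINT t|unit_lborel. indicator {..<?b} t * rearrangement M y t
          - indicator {..<?a} t * rearrangement M y t)"
    using i[of ?a] i[of ?b] by (intro integral_cong_AE) auto
  then show ?thesis
    unfolding level_integral_eq_unit_lborel[OF xm rearrangement_measurable[OF ym]]
    using i by (simp add: head_integral_def)
qed

text \<open>
  Both measures are maximisers of \<open>F\<^sub>x(r) - c r\<close>, so \<open>F\<^sub>x\<close> has slope \<open>c\<close> between them.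
\<close>

lemma head_integral_level_diff:
  assumes x: "integrable M x"
  shows "head_integral M x (prob {\<omega>\<in>space M. x \<omega> \<ge> c})
      - head_integral M x (prob {\<omega>\<in>space M. x \<omega> > c}) = c * prob {\<omega>\<in>space M. x \<omega> = c}"
proof -
  have [measurable]: "x \<in> borel_measurable M" using x by auto
  have "prob {\<omega>\<in>space M. x \<omega> \<ge> c} = prob ({\<omega>\<in>space M. x \<omega> = c} \<union> {\<omega>\<in>space M. x \<omega> > c})"
    by (intro arg_cong[where f = prob]) auto
  also have "\<dots> = prob {\<omega>\<in>space M. x \<omega> = c} + prob {\<omega>\<in>space M. x \<omega> > c}"
    by (intro finite_measure_Union) auto
  finally have p: "prob {\<omega>\<in>space M. x \<omega> = c}
      = prob {\<omega>\<in>space M. x \<omega> \<ge> c} - prob {\<omega>\<in>space M. x \<omega> > c}" by simp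
  have "head_integral M x r - c * r = stop_loss M x c"
    if "r = prob {\<omega>\<in>space M. x \<omega> \<ge> c} \<or> r = prob {\<omega>\<in>space M. x \<omega> > c}" for r
    using that prob_greater_le_ge[of x c] by (intro head_integral_eq_stop_loss_level[OF x]) auto
  from this[of "prob {\<omega>\<in>space M. x \<omega> \<ge> c}"] this[of "prob {\<omega>\<in>space M. x \<omega> > c}"]
  show ?thesis by (simp add: p algebra_simps)
qed

lemma integral_excess:
  assumes f: "integrable M f" and B: "B \<in> events"
  shows integrable_indicator_excess: "integrable M (\<lambda>\<omega>. indicator B \<omega> * (f \<omega> - s))"
    and integral_indicator_excess: "(LINT \<omega>|M. indicator B \<omega> * (f \<omega> - s))
      = (LINT \<omega>|M. indicator B \<omega> * f \<omega>) - s * prob B"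
proof -
  have i: "integrable M (\<lambda>\<omega>. indicator B \<omega> * f \<omega>)"
    using integrable_real_mult_indicator[OF B f] by (simp add: mult.commute)
  have j: "integrable M (indicator B :: _ \<Rightarrow> real)"
    using B by (intro integrable_real_indicator) (auto simp: emeasure_eq_measure)
  have eq: "indicator B \<omega> * (f \<omega> - s) = indicator B \<omega> * f \<omega> - s * indicator B \<omega>" for \<omega>
    by (simp add: algebra_simps)
  show "integrable M (\<lambda>\<omega>. indicator B \<omega> * (f \<omega> - s))"
    unfolding eq using i j by (intro Bochner_Integration.integrable_diff) auto
  show "(LINT \<omega>|M. indicator B \<omega> * (f \<omega> - s))
      = (LINT \<omega>|M. indicator B \<omega> * f \<omega>) - s * prob B"
    unfolding eq using i j B by (subst Bochner_Integration.integral_diff) auto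
qed

lemma integral_excess_le_stop_loss:
  assumes f: "integrable M f" and B: "B \<in> events"
  shows "(LINT \<omega>|M. indicator B \<omega> * f \<omega>) - s * prob B \<le> stop_loss M f s"
  unfolding integral_indicator_excess[OF f B, symmetric] stop_loss_def
  by (intro integral_mono integrable_stop_loss f integrable_indicator_excess B)
    (auto simp: indicator_def)

text \<open>
  The positive part of \<open>f - s\<close> dominates \<open>f - s\<close> restricted to \<open>B\<close>; equal integrals make the two agree
  almost everywhere.
\<close>

lemma integral_excess_eq_stop_lossD:
  assumes f: "integrable M f" and B: "B \<in> events"
    and eq: "(LINT \<omega>|M. indicator B \<omega> * f \<omega>) - s * prob B = stop_loss M f s"
  shows "AE \<omega> in M. (\<omega> \<in> B \<longrightarrow> s \<le> f \<omega>) \<and> (\<omega> \<notin> B \<longrightarrow> f \<omega> \<le> s)"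
proof -
  let ?d = "\<lambda>\<omega>. max 0 (f \<omega> - s) - indicator B \<omega> * (f \<omega> - s)"
  have id: "integrable M ?d"
    by (intro Bochner_Integration.integrable_diff integrable_stop_loss f
        integrable_indicator_excess B)
  have "(LINT \<omega>|M. ?d \<omega>) = 0"
    using eq by (subst Bochner_Integration.integral_diff)
      (auto intro: integrable_stop_loss f integrable_indicator_excess B
        simp: integral_indicator_excess[OF f B] stop_loss_def)
  moreover have "AE \<omega> in M. 0 \<le> ?d \<omega>" by (intro AE_I2) (auto simp: indicator_def)
  ultimately have "AE \<omega> in M. ?d \<omega> = 0"
    using integral_nonneg_eq_0_iff_AE[OF id] by simp
  then show ?thesis
    by eventually_elim (auto simp: indicator_def max_def split: if_splits)
qed

text \<open>
  The Hardy-Littlewood inequality. For \<open>0 < prob B < 1\<close> it is weak duality for \<open>f\<close> on \<open>B\<close>, at the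
  threshold for which duality for the rearrangement is sharp.
\<close>

lemma integral_le_head_integral:
  assumes f: "integrable M f" and B: "B \<in> events"
  shows "(LINT \<omega>|M. indicator B \<omega> * f \<omega>) \<le> head_integral M f (prob B)"
proof -
  consider "prob B = 0" | "0 < prob B" "prob B < 1" | "prob B = 1"
    using prob_le_1[of B] measure_nonneg[of M B] by linarith
  then show ?thesis
  proof cases
    case 1
    then have "AE \<omega> in M. \<omega> \<notin> B" using B by (simp add: AE_iff_measurable[OF _ refl] prob_eq_0)
    then have "AE \<omega> in M. indicator B \<omega> * f \<omega> = 0" by eventually_elim simp
    then have "(LINT \<omega>|M. indicator B \<omega> * f \<omega>) = 0"
      by (rule integral_eq_zero_AE)
    then show ?thesis using 1 by (simp add: head_integral_0)
  next
    case 2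
    show ?thesis
      using integral_excess_le_stop_loss[OF f B, of "rearrangement M f (prob B)"]
        head_integral_eq_stop_loss_rearrangement[OF f 2] by simp
  next
    case 3
    then have "AE \<omega> in M. \<omega> \<in> B" using B by (simp add: prob_eq_1)
    then have "AE \<omega> in M. indicator B \<omega> * f \<omega> = f \<omega>" by eventually_elim simp
    then have "(LINT \<omega>|M. indicator B \<omega> * f \<omega>) = (LINT \<omega>|M. f \<omega>)"
      using f B by (intro integral_cong_AE) auto
    then show ?thesis using 3 by (simp add: head_integral_1[OF f])
  qed
qed

lemma integral_upper_level_eq:
  fixes f :: "'a \<Rightarrow> real"
  assumes f: "integrable M f"
    and U: "U = {\<omega>\<in>space M. f \<omega> > s} \<or> U = {\<omega>\<in>space M. f \<omega> \<ge> s}"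
  shows "(LINT \<omega>|M. indicator U \<omega> * f \<omega>) = head_integral M f (prob U)"
proof -
  note [measurable] = borel_measurable_integrable[OF f]
  have B: "U \<in> events" using U by auto
  have "head_integral M f (prob U) - s * prob U = stop_loss M f s"
    using U prob_greater_le_ge[of f s] by (intro head_integral_eq_stop_loss_level f) auto
  moreover have "(LINT \<omega>|M. indicator U \<omega> * f \<omega>) - s * prob U = stop_loss M f s"
    unfolding integral_indicator_excess[OF f B, symmetric] stop_loss_def using U
    by (intro Bochner_Integration.integral_cong) (auto simp: indicator_def)
  ultimately show ?thesis by simp
qed

section \<open>Majorisation as an order of stop-loss transforms\<close>

text \<open>
  Each direction inserts the optimal partner of the other variable: for given \<open>s\<close> the
  cut \<open>r\<close> at which \<open>g\<close> attains \<open>\<Phi>\<^sub>g(s)\<close>, and for given \<open>r\<close> the threshold \<open>s\<close> at which \<open>F\<^sub>f(r)\<close> is attained.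
\<close>

lemma majorised_by_iff_stop_loss:
  assumes g: "integrable M g" and f: "integrable M f"
  shows "majorised_by M g f \<longleftrightarrow>
    (LINT \<omega>|M. g \<omega>) = (LINT \<omega>|M. f \<omega>) \<and> (\<forall>s. stop_loss M g s \<le> stop_loss M f s)"
    (is "_ \<longleftrightarrow> ?R")
proof
  assume "majorised_by M g f"
  then have eq: "head_integral M g 1 = head_integral M f 1"
    and le: "0 \<le> r \<Longrightarrow> r \<le> 1 \<Longrightarrow> head_integral M g r \<le> head_integral M f r" for r
    by (auto simp: majorised_by_iff_head_integral less_le)
  have "stop_loss M g s \<le> stop_loss M f s" for s
  proof -
    let ?r = "prob {\<omega>\<in>space M. g \<omega> > s}"
    have "stop_loss M g s = head_integral M g ?r - s * ?r"
      using head_integral_eq_stop_loss_level[OF g, of s ?r] prob_greater_le_ge[of g s] g by simp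
    also have "\<dots> \<le> head_integral M f ?r - s * ?r" using le[of ?r] by simp
    also have "\<dots> \<le> stop_loss M f s" by (rule head_integral_le_stop_loss[OF f]) auto
    finally show ?thesis .
  qed
  then show ?R using eq by (simp add: head_integral_1[OF g] head_integral_1[OF f])
next
  assume R: ?R
  have "head_integral M g r \<le> head_integral M f r" if r: "r \<in> {0..<1}" for r
  proof (cases "r = 0")
    case False
    let ?s = "rearrangement M f r"
    have "head_integral M g r - ?s * r \<le> stop_loss M f ?s"
      using head_integral_le_stop_loss[OF g, of r ?s] R r by (auto intro: order_trans)
    then show ?thesis
      using head_integral_eq_stop_loss_rearrangement[OF f, of r] r False by simp
  qed (simp add: head_integral_0)
  then show "majorised_by M g f"
    using R by (simp add: majorised_by_iff_head_integral head_integral_1[OF g] head_integral_1[OF f])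
qed

lemma head_integral_mono_majorised:
  assumes "integrable M g" "integrable M f" "majorised_by M g f" "0 \<le> r" "r \<le> 1"
  shows "head_integral M g r \<le> head_integral M f r"
  using assms by (cases "r = 1") (auto simp: majorised_by_iff_head_integral)

lemma stop_loss_lipschitz:
  assumes f: "integrable M f"
  shows "\<bar>stop_loss M f s - stop_loss M f t\<bar> \<le> \<bar>s - t\<bar>"
proof -
  have "\<bar>stop_loss M f s - stop_loss M f t\<bar>
      = \<bar>LINT \<omega>|M. max 0 (f \<omega> - s) - max 0 (f \<omega> - t)\<bar>"
    using integrable_stop_loss[OF f] by (simp add: stop_loss_def)
  also have "\<dots> \<le> (LINT \<omega>|M. \<bar>max 0 (f \<omega> - s) - max 0 (f \<omega> - t)\<bar>)"
    by (rule integral_abs_bound)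
  also have "\<dots> \<le> (LINT \<omega>|M. \<bar>s - t\<bar>)"
    using integrable_stop_loss[OF f]
    by (intro integral_mono integrable_abs Bochner_Integration.integrable_diff) auto
  finally show ?thesis by (simp add: prob_space)
qed

lemma continuous_on_stop_loss:
  assumes f: "integrable M f"
  shows "continuous_on S (stop_loss M f)"
proof -
  have "1-lipschitz_on S (stop_loss M f)"
    using stop_loss_lipschitz[OF f] by (auto simp: lipschitz_on_def dist_real_def)
  then show ?thesis by (rule lipschitz_on_continuous_on)
qed

section \<open>Extreme points satisfy the level condition\<close>

lemma stop_loss_perturb:
  assumes f: "integrable M f" and g: "integrable M g"
    and e: "\<And>\<omega>. \<omega> \<in> space M \<Longrightarrow> \<bar>g \<omega> - f \<omega>\<bar> \<le> e"
  shows "stop_loss M g s \<le> stop_loss M f s + e"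
proof -
  have "stop_loss M g s \<le> (LINT \<omega>|M. max 0 (f \<omega> - s) + e)"
    unfolding stop_loss_def
    using integrable_stop_loss[OF f] integrable_stop_loss[OF g]
  proof (intro integral_mono Bochner_Integration.integrable_add)
    fix \<omega> assume "\<omega> \<in> space M"
    then show "max 0 (g \<omega> - s) \<le> max 0 (f \<omega> - s) + e" using e[of \<omega>] by linarith
  qed auto
  also have "\<dots> = stop_loss M f s + e"
    using integrable_stop_loss[OF f] by (simp add: stop_loss_def prob_space)
  finally show ?thesis .
qed

text \<open>
  A perturbation of size at most \<open>e\<close> with mean zero, living where \<open>p \<le> x \<le> q\<close>, leaves \<open>\<Phi>\<^sub>x(s)\<close>
  unchanged unless \<open>p - e \<le> s \<le> q + e\<close>. There it raises \<open>\<Phi>\<^sub>x\<close> by at most \<open>e\<close>, and comparing \<open>s\<close> with the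
  nearest point of \<open>[p,q]\<close> costs another \<open>e\<close> for each of \<open>\<Phi>\<^sub>x\<close> and \<open>\<Phi>\<^sub>y\<close>; hence the gap of \<open>3 * e\<close>.
\<close>

lemma perturbation_in_Omega:
  assumes x: "x \<in> Omega M y" and y: "integrable M y"
    and pq: "p \<le> q" and e: "0 \<le> e"
    and gap: "\<And>s. p \<le> s \<Longrightarrow> s \<le> q \<Longrightarrow> stop_loss M x s + 3 * e \<le> stop_loss M y s"
    and g: "integrable M g" and g0: "(LINT \<omega>|M. g \<omega>) = 0"
    and ge: "\<And>\<omega>. \<omega> \<in> space M \<Longrightarrow> \<bar>g \<omega>\<bar> \<le> e"
    and gpq: "\<And>\<omega>. \<omega> \<in> space M \<Longrightarrow> g \<omega> \<noteq> 0 \<Longrightarrow> p \<le> x \<omega> \<and> x \<omega> \<le> q"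
  shows "(\<lambda>\<omega>. x \<omega> + g \<omega>) \<in> Omega M y"
proof -
  have xi: "integrable M x" and xy: "(LINT \<omega>|M. x \<omega>) = (LINT \<omega>|M. y \<omega>)"
    and le: "stop_loss M x s \<le> stop_loss M y s" for s
    using x y by (auto simp: Omega_def majorised_by_iff_stop_loss)
  have ai: "integrable M (\<lambda>\<omega>. x \<omega> + g \<omega>)" using xi g by simp
  have "stop_loss M (\<lambda>\<omega>. x \<omega> + g \<omega>) s \<le> stop_loss M y s" for s
  proof -
    consider "q + e < s" | "s < p - e" | "p - e \<le> s" "s \<le> q + e" by linarith
    then show ?thesis
    proof cases
      case 1
      have "stop_loss M (\<lambda>\<omega>. x \<omega> + g \<omega>) s = stop_loss M x s"
        unfolding stop_loss_def
      proof (intro Bochner_Integration.integral_cong refl)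
        fix \<omega> assume "\<omega> \<in> space M"
        then show "max 0 (x \<omega> + g \<omega> - s) = max 0 (x \<omega> - s)"
          using 1 ge[of \<omega>] gpq[of \<omega>] by (cases "g \<omega> = 0") auto
      qed
      then show ?thesis using le by simp
    next
      case 2
      have "stop_loss M (\<lambda>\<omega>. x \<omega> + g \<omega>) s = (LINT \<omega>|M. max 0 (x \<omega> - s) + g \<omega>)"
        unfolding stop_loss_def
      proof (intro Bochner_Integration.integral_cong refl)
        fix \<omega> assume "\<omega> \<in> space M"
        then show "max 0 (x \<omega> + g \<omega> - s) = max 0 (x \<omega> - s) + g \<omega>"
          using 2 ge[of \<omega>] gpq[of \<omega>] by (cases "g \<omega> = 0") auto
      qed
      also have "\<dots> = stop_loss M x s"
        using integrable_stop_loss[OF xi] g g0 by (simp add: stop_loss_def)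
      finally show ?thesis using le by simp
    next
      case 3
      let ?s = "max p (min q s)"
      have s: "\<bar>s - ?s\<bar> \<le> e" using 3 pq e by (auto simp: max_def min_def)
      have "stop_loss M (\<lambda>\<omega>. x \<omega> + g \<omega>) s \<le> stop_loss M x s + e"
        using ge by (intro stop_loss_perturb xi ai) auto
      moreover have "stop_loss M x ?s + 3 * e \<le> stop_loss M y ?s"
        using pq by (intro gap) auto
      ultimately show ?thesis
        using s stop_loss_lipschitz[OF xi, of s ?s] stop_loss_lipschitz[OF y, of s ?s] by linarith
    qed
  qed
  then show ?thesis
    using ai y xi g xy g0 by (auto simp: Omega_def majorised_by_iff_stop_loss)
qed

lemma ae_extreme_pointD:
  assumes "ae_extreme_point_of M x S" "a \<in> S" "b \<in> S" "0 < u" "u < 1"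
    and "AE \<omega> in M. x \<omega> = (1 - u) * a \<omega> + u * b \<omega>"
  shows "AE \<omega> in M. a \<omega> = b \<omega>"
  using assms unfolding ae_extreme_point_of_def by blast

text \<open>
  On the compact interval \<open>[p,q]\<close> the gap between the transforms is bounded below, so mass can be
  exchanged between \<open>B\<close> and \<open>C\<close> in either direction without leaving the set majorised by \<open>y\<close>.
\<close>

lemma extreme_point_indecomposable:
  assumes ext: "ae_extreme_point_of M x (Omega M y)" and y: "integrable M y"
    and gap: "\<And>s. p \<le> s \<Longrightarrow> s \<le> q \<Longrightarrow> stop_loss M x s < stop_loss M y s"
    and B: "B \<in> events" "C \<in> events" "B \<inter> C = {}"
    and Bpq: "\<And>\<omega>. \<omega> \<in> B \<union> C \<Longrightarrow> p \<le> x \<omega> \<and> x \<omega> \<le> q"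
  shows "prob B = 0 \<or> prob C = 0"
proof (rule ccontr)
  assume "\<not> ?thesis"
  then have pos: "0 < prob B" "0 < prob C" by (auto simp: zero_less_measure_iff)
  have x: "x \<in> Omega M y" using ext by (simp add: ae_extreme_point_of_def)
  then have xi: "integrable M x" by (simp add: Omega_def)
  have "B \<noteq> {}" using pos by auto
  then have pq: "p \<le> q" using Bpq by force
  have "continuous_on {p..q} (\<lambda>s. stop_loss M y s - stop_loss M x s)"
    by (intro continuous_intros continuous_on_stop_loss xi y)
  then obtain s0 where s0: "s0 \<in> {p..q}"
    "\<And>s. s \<in> {p..q} \<Longrightarrow> stop_loss M y s0 - stop_loss M x s0 \<le> stop_loss M y s - stop_loss M x s"
    using continuous_attains_inf[of "{p..q}" "\<lambda>s. stop_loss M y s - stop_loss M x s"] pq by auto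
  define e where "e = (stop_loss M y s0 - stop_loss M x s0) / 3"
  have e: "0 < e" using gap[of s0] s0(1) by (simp add: e_def)
  have gap_e: "stop_loss M x s + 3 * e \<le> stop_loss M y s" if "p \<le> s" "s \<le> q" for s
  proof -
    have "3 * e = stop_loss M y s0 - stop_loss M x s0" by (simp add: e_def)
    then show ?thesis using s0(2)[of s] that by simp
  qed
  \<comment> \<open>The weights make the mean vanish; being probabilities, they keep \<open>\<bar>g\<bar> \<le> e\<close>.\<close>
  define g where "g = (\<lambda>\<omega>. e * (prob C * indicator B \<omega> - prob B * indicator C \<omega>))"
  have ind: "integrable M (indicator A :: _ \<Rightarrow> real)" if "A \<in> events" for A
    using that by (intro integrable_real_indicator) (auto simp: emeasure_eq_measure)
  have gi: "integrable M g" unfolding g_def using ind B by auto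
  have g0: "(LINT \<omega>|M. g \<omega>) = 0" unfolding g_def using ind B by simp
  have ge: "\<bar>g \<omega>\<bar> \<le> e" for \<omega>
    using e B(3) by (auto simp: g_def indicator_def abs_mult)
  have gpq: "p \<le> x \<omega> \<and> x \<omega> \<le> q" if "g \<omega> \<noteq> 0" for \<omega>
    using that Bpq[of \<omega>] by (cases "\<omega> \<in> B"; cases "\<omega> \<in> C") (auto simp: g_def)
  have a: "(\<lambda>\<omega>. x \<omega> + g \<omega>) \<in> Omega M y"
    using gi g0 ge gpq gap_e by (intro perturbation_in_Omega[OF x y pq less_imp_le[OF e]]) auto
  have b: "(\<lambda>\<omega>. x \<omega> + - g \<omega>) \<in> Omega M y"
    using gi g0 ge gpq gap_e by (intro perturbation_in_Omega[OF x y pq less_imp_le[OF e]]) auto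
  have "AE \<omega> in M. x \<omega> = (1 - 1/2) * (x \<omega> + g \<omega>) + 1/2 * (x \<omega> + - g \<omega>)"
    by (intro AE_I2) (simp add: field_simps)
  then have "AE \<omega> in M. x \<omega> + g \<omega> = x \<omega> + - g \<omega>"
    by (intro ae_extreme_pointD[OF ext a b, of "1/2"]) auto
  then have "AE \<omega> in M. \<omega> \<notin> B"
  proof eventually_elim
    case (elim \<omega>)
    then show ?case using e pos B(3) by (cases "\<omega> \<in> C") (auto simp: g_def)
  qed
  then have "prob B = 0" using B(1) by (simp add: AE_iff_measurable[OF _ refl] prob_eq_0)
  then show False using pos by simp
qed

text \<open>
  Suppose the transforms agree at \<open>c = \<lambda>\<^sub>x(t)\<close>. Then \<open>F\<^sub>x(t) = F\<^sub>y(t)\<close>, and \<open>t\<close> maximises \<open>F\<^sub>y(r) - c r\<close>.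
  To the right of \<open>t\<close> the function \<open>F\<^sub>y\<close> would grow faster than \<open>c\<close> if \<open>c < \<lambda>\<^sub>y(t)\<close>, contradicting the maximum,
  and it would fall below \<open>F\<^sub>x\<close> if \<open>\<lambda>\<^sub>y(t) < c\<close>. The measure \<open>r\<close> of a superlevel set for an
  intermediate threshold \<open>d'\<close> serves as the point to the right of \<open>t\<close>.
\<close>

lemma rearrangement_neq_imp_stop_loss_less:
  assumes x: "integrable M x" and y: "integrable M y" and maj: "majorised_by M x y"
    and t: "0 < t" "t < 1" and ne: "rearrangement M x t \<noteq> rearrangement M y t"
  shows "stop_loss M x (rearrangement M x t) < stop_loss M y (rearrangement M x t)"
proof (rule ccontr)
  have xm: "x \<in> borel_measurable M" and ym: "y \<in> borel_measurable M" using x y by auto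
  let ?c = "rearrangement M x t" and ?d = "rearrangement M y t"
  let ?F = "head_integral M x" and ?G = "head_integral M y"
  assume "\<not> ?thesis"
  then have ge: "stop_loss M y ?c \<le> stop_loss M x ?c" by simp
  have FG: "?F r \<le> ?G r" if "0 \<le> r" "r \<le> 1" for r
    using head_integral_mono_majorised[OF x y maj that] .
  have Ft: "?F t - ?c * t = stop_loss M x ?c"
    by (rule head_integral_eq_stop_loss_rearrangement[OF x t])
  have Gt: "?G t - ?d * t = stop_loss M y ?d"
    by (rule head_integral_eq_stop_loss_rearrangement[OF y t])
  have eq: "?F t = ?G t" "stop_loss M y ?c = ?G t - ?c * t"
    using FG[of t] t Ft ge head_integral_le_stop_loss[OF y, of t ?c] by auto
  consider "?c < ?d" | "?d < ?c" using ne by linarith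
  then show False
  proof cases
    case 1
    then obtain d' where d': "?c < d'" "d' < ?d" using dense by blast
    define r where "r = prob {\<omega>\<in>space M. y \<omega> > d'}"
    have r: "t < r" "r \<le> 1" using less_rearrangement_iff[OF ym t, of d'] d' by (auto simp: r_def)
    have "?G r - d' * r = stop_loss M y d'"
      using prob_greater_le_ge[OF ym, of d'] unfolding r_def
      by (intro head_integral_eq_stop_loss_level y) auto
    also have "\<dots> \<ge> ?G t - d' * t" using t by (intro head_integral_le_stop_loss y) auto
    finally have "?G t - ?G r \<le> d' * (t - r)" by (simp add: algebra_simps)
    also have "\<dots> < ?c * (t - r)" using d' r by (intro mult_strict_right_mono_neg) auto
    finally have "?G t - ?c * t < ?G r - ?c * r" by (simp add: algebra_simps)
    moreover have "?G r - ?c * r \<le> stop_loss M y ?c"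
      using r t by (intro head_integral_le_stop_loss y) auto
    ultimately show False using eq by simp
  next
    case 2
    then obtain d' where d': "?d < d'" "d' < ?c" using dense by blast
    define r where "r = prob {\<omega>\<in>space M. x \<omega> > d'}"
    have r: "t < r" "r \<le> 1" using less_rearrangement_iff[OF xm t, of d'] d' by (auto simp: r_def)
    have "?F r - d' * r = stop_loss M x d'"
      using prob_greater_le_ge[OF xm, of d'] unfolding r_def
      by (intro head_integral_eq_stop_loss_level x) auto
    also have "\<dots> \<ge> ?F t - d' * t" using t by (intro head_integral_le_stop_loss x) auto
    finally have "?F t - ?F r \<le> d' * (t - r)" by (simp add: algebra_simps)
    also have "\<dots> < ?d * (t - r)" using d' r by (intro mult_strict_right_mono_neg) auto
    also have "\<dots> \<le> ?G t - ?G r"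
      using Gt head_integral_le_stop_loss[OF y, of r ?d] r t by (simp add: algebra_simps)
    finally show False using FG[of r] eq r t by simp
  qed
qed

lemma AE_not_between_stop_loss_gap:
  assumes ext: "ae_extreme_point_of M x (Omega M y)" and y: "integrable M y"
    and gap: "\<And>s. p \<le> s \<Longrightarrow> s \<le> q \<Longrightarrow> stop_loss M x s < stop_loss M y s"
    and c: "p \<le> c" "c \<le> q" "0 < prob {\<omega>\<in>space M. x \<omega> = c}"
  shows "AE \<omega> in M. p \<le> x \<omega> \<and> x \<omega> \<le> q \<longrightarrow> x \<omega> = c"
proof -
  have [measurable]: "x \<in> borel_measurable M"
    using ext by (auto simp: ae_extreme_point_of_def Omega_def)
  have "prob {\<omega>\<in>space M. x \<omega> = c} = 0 \<or> prob {\<omega>\<in>space M. p \<le> x \<omega> \<and> x \<omega> \<le> q \<and> x \<omega> \<noteq> c} = 0"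
    using c by (intro extreme_point_indecomposable[OF ext y gap]) auto
  then have "prob {\<omega>\<in>space M. p \<le> x \<omega> \<and> x \<omega> \<le> q \<and> x \<omega> \<noteq> c} = 0" using c by simp
  then have "AE \<omega> in M. \<not> (p \<le> x \<omega> \<and> x \<omega> \<le> q \<and> x \<omega> \<noteq> c)"
    by (subst (asm) prob_eq_0) auto
  then show ?thesis by eventually_elim auto
qed

text \<open>
  Every strip \<open>{c - d < x \<le> c}\<close> has positive measure because \<open>c\<close> is a value of the rearrangement. A
  short strip cannot be split into two parts of positive measure, so its part where \<open>x \<le> c - d\<close> is null
  for each \<open>d > 0\<close>, and all its mass sits at \<open>c\<close>.
\<close>

lemma extreme_point_level_pos:
  assumes ext: "ae_extreme_point_of M x (Omega M y)" and y: "integrable M y"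
    and t: "0 < t" "t < 1"
    and gap: "stop_loss M x (rearrangement M x t) < stop_loss M y (rearrangement M x t)"
  shows "0 < prob {\<omega>\<in>space M. x \<omega> = rearrangement M x t}"
proof -
  have x: "integrable M x" using ext by (auto simp: ae_extreme_point_of_def Omega_def)
  then have [measurable]: "x \<in> borel_measurable M" by auto
  define c where "c = rearrangement M x t"
  define m where "m = stop_loss M y c - stop_loss M x c"
  have m: "0 < m" using gap by (simp add: m_def c_def)
  define e where "e = m / 3"
  have e: "0 < e" using m by (simp add: e_def)
  \<comment> \<open>Both transforms are 1-Lipschitz, so the gap \<open>m\<close> at \<open>c\<close> survives within distance \<open>m / 3\<close>.\<close>
  have gap_e: "stop_loss M x s < stop_loss M y s" if "c - e \<le> s" "s \<le> c" for s
  proof -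
    have "\<bar>s - c\<bar> \<le> e" using that by auto
    then show ?thesis
      using stop_loss_lipschitz[OF x, of s c] stop_loss_lipschitz[OF y, of s c] m
      by (auto simp: e_def m_def abs_le_iff)
  qed
  have pos: "0 < prob {\<omega>\<in>space M. c - d < x \<omega> \<and> x \<omega> \<le> c}" if "0 < d" for d
  proof -
    have "prob {\<omega>\<in>space M. x \<omega> > c} \<le> t"
      using rearrangement_le_iff[of x t c] t by (simp add: c_def)
    moreover have "t < prob {\<omega>\<in>space M. x \<omega> > c - d}"
      using less_rearrangement_iff[of x t "c - d"] t that by (simp add: c_def)
    moreover have "prob {\<omega>\<in>space M. x \<omega> > c - d}
        = prob ({\<omega>\<in>space M. c - d < x \<omega> \<and> x \<omega> \<le> c} \<union> {\<omega>\<in>space M. x \<omega> > c})"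
      using that by (intro arg_cong[where f = prob]) auto
    moreover have "\<dots> = prob {\<omega>\<in>space M. c - d < x \<omega> \<and> x \<omega> \<le> c} + prob {\<omega>\<in>space M. x \<omega> > c}"
      by (intro finite_measure_Union) auto
    ultimately show ?thesis by linarith
  qed
  have null: "AE \<omega> in M. \<not> (c - e < x \<omega> \<and> x \<omega> \<le> c - d)" if d: "0 < d" "d < e" for d
  proof -
    have "prob {\<omega>\<in>space M. c - d < x \<omega> \<and> x \<omega> \<le> c} = 0
        \<or> prob {\<omega>\<in>space M. c - e < x \<omega> \<and> x \<omega> \<le> c - d} = 0"
      using d by (intro extreme_point_indecomposable[OF ext y gap_e]) auto
    then have "prob {\<omega>\<in>space M. c - e < x \<omega> \<and> x \<omega> \<le> c - d} = 0"
      using pos[OF d(1)] by simp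
    then show ?thesis by (subst (asm) prob_eq_0) auto
  qed
  have "AE \<omega> in M. \<forall>n. \<not> (c - e < x \<omega> \<and> x \<omega> \<le> c - e / (real n + 2))"
  proof (subst AE_all_countable, intro allI null)
    fix n
    show "0 < e / (real n + 2)" using e by simp
    have "e * 1 < e * (real n + 2)" using e by (intro mult_strict_left_mono) auto
    then show "e / (real n + 2) < e" by (simp add: field_simps)
  qed
  then have "AE \<omega> in M. \<not> (c - e < x \<omega> \<and> x \<omega> < c)"
  proof eventually_elim
    case (elim \<omega>)
    show ?case
    proof
      assume a: "c - e < x \<omega> \<and> x \<omega> < c"
      obtain n where n: "e / (c - x \<omega>) < real n" using reals_Archimedean2 by blast
      have "e / (real n + 2) \<le> c - x \<omega>"
      proof -
        have "e < real n * (c - x \<omega>)" using n a by (simp add: field_simps)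
        also have "\<dots> \<le> (real n + 2) * (c - x \<omega>)" using a by (intro mult_right_mono) auto
        finally show ?thesis using a by (simp add: field_simps)
      qed
      then show False using elim[rule_format, of n] a by auto
    qed
  qed
  then have "AE \<omega> in M. \<omega> \<in> {\<omega>\<in>space M. c - e < x \<omega> \<and> x \<omega> \<le> c} \<longleftrightarrow> \<omega> \<in> {\<omega>\<in>space M. x \<omega> = c}"
    by eventually_elim (use e in auto)
  then have "prob {\<omega>\<in>space M. c - e < x \<omega> \<and> x \<omega> \<le> c} = prob {\<omega>\<in>space M. x \<omega> = c}"
    by (intro finite_measure_eq_AE) auto
  then show ?thesis using pos[OF e] by (simp add: c_def)
qed

lemma extreme_point_level_atom:
  assumes ext: "ae_extreme_point_of M x (Omega M y)" and y: "integrable M y"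
    and gap: "stop_loss M x c < stop_loss M y c"
    and pos: "0 < prob {\<omega>\<in>space M. x \<omega> = c}"
  shows "measure_atom M {\<omega>\<in>space M. x \<omega> = c}"
proof -
  have [measurable]: "x \<in> borel_measurable M"
    using ext by (auto simp: ae_extreme_point_of_def Omega_def)
  let ?A = "{\<omega>\<in>space M. x \<omega> = c}"
  have "prob B = 0 \<or> prob B = prob ?A" if B: "B \<in> events" "B \<subseteq> ?A" for B
  proof -
    have "prob B = 0 \<or> prob (?A - B) = 0"
    proof (rule extreme_point_indecomposable[OF ext y])
      show "stop_loss M x s < stop_loss M y s" if "c \<le> s" "s \<le> c" for s
        using gap that by (simp add: order_antisym)
    qed (use B in auto)
    then show ?thesis using B finite_measure_Diff[of ?A B] by auto
  qed
  then show ?thesis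
    using pos by (auto simp: measure_atom_def emeasure_eq_measure)
qed

text \<open>
  At a contact point \<open>s\<close> that separates the values of \<open>x\<close> on \<open>B\<close> from those off \<open>B\<close>, the line of slope
  \<open>s\<close> touching \<open>F\<^sub>x\<close> at \<open>prob B\<close> also bounds \<open>F\<^sub>y\<close> from above.
\<close>

lemma head_integral_eq_of_touching:
  assumes x: "integrable M x" and y: "integrable M y" and maj: "majorised_by M x y"
    and B: "B \<in> events" and AE: "AE \<omega> in M. (\<omega> \<in> B \<longrightarrow> s \<le> x \<omega>) \<and> (\<omega> \<notin> B \<longrightarrow> x \<omega> \<le> s)"
    and eq: "stop_loss M x s = stop_loss M y s"
  shows "head_integral M x (prob B) = head_integral M y (prob B)"
proof -
  note [measurable] = borel_measurable_integrable[OF x] B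
  have "AE \<omega> in M. max 0 (x \<omega> - s) = indicator B \<omega> * (x \<omega> - s)"
    using AE by eventually_elim (auto simp: indicator_def)
  then have "stop_loss M x s = (LINT \<omega>|M. indicator B \<omega> * (x \<omega> - s))"
    unfolding stop_loss_def by (intro integral_cong_AE) auto
  also have "\<dots> \<le> head_integral M x (prob B) - s * prob B"
    using integral_le_head_integral[OF x B] by (simp add: integral_indicator_excess[OF x B])
  finally show ?thesis
    using eq head_integral_le_stop_loss[OF y, of "prob B" s]
      head_integral_mono_majorised[OF x y maj, of "prob B"] by simp
qed

text \<open>
  If \<open>{x > c}\<close> is not null, there is a nearest contact point \<open>h\<close> above \<open>c\<close>: without one, \<open>x\<close> could not
  exceed \<open>c\<close>. Between \<open>c\<close> and \<open>h\<close> the function \<open>x\<close> takes almost no values, so \<open>h\<close> separates \<open>{x > c}\<close>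
  from its complement.
\<close>

lemma extreme_point_head_integral_greater:
  assumes ext: "ae_extreme_point_of M x (Omega M y)" and y: "integrable M y"
    and gap: "stop_loss M x c < stop_loss M y c"
    and pos: "0 < prob {\<omega>\<in>space M. x \<omega> = c}"
  defines "r \<equiv> prob {\<omega>\<in>space M. x \<omega> > c}"
  shows "head_integral M x r = head_integral M y r"
proof (cases "r = 0")
  case True
  then show ?thesis by (simp add: head_integral_0)
next
  case False
  have x: "integrable M x" and maj: "majorised_by M x y"
    using ext by (auto simp: ae_extreme_point_of_def Omega_def)
  then have [measurable]: "x \<in> borel_measurable M" by auto
  have le: "stop_loss M x s \<le> stop_loss M y s" for s
    using maj x y by (simp add: majorised_by_iff_stop_loss)
  define S where "S = {s. c \<le> s \<and> stop_loss M x s = stop_loss M y s}"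
  have gapI: "AE \<omega> in M. c \<le> x \<omega> \<and> x \<omega> \<le> q \<longrightarrow> x \<omega> = c"
    if "c \<le> q" "\<And>s. c \<le> s \<Longrightarrow> s \<le> q \<Longrightarrow> s \<notin> S" for q
  proof (rule AE_not_between_stop_loss_gap[OF ext y _ order_refl that(1) pos])
    show "stop_loss M x s < stop_loss M y s" if "c \<le> s" "s \<le> q" for s
      using \<open>\<And>s. c \<le> s \<Longrightarrow> s \<le> q \<Longrightarrow> s \<notin> S\<close>[OF that] that(1) le[of s]
      unfolding S_def by fastforce
  qed
  have "S \<noteq> {}"
  proof
    assume "S = {}"
    then have "AE \<omega> in M. \<forall>n. c \<le> x \<omega> \<and> x \<omega> \<le> c + real n \<longrightarrow> x \<omega> = c"
      by (subst AE_all_countable, intro allI gapI) auto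
    then have "AE \<omega> in M. \<not> x \<omega> > c"
    proof eventually_elim
      case (elim \<omega>)
      obtain n where "x \<omega> - c < real n" using reals_Archimedean2 by blast
      then show ?case using elim[rule_format, of n] by auto
    qed
    then have "r = 0" unfolding r_def by (subst prob_eq_0) auto
    then show False using False by simp
  qed
  moreover have bdd: "bdd_below S" by (auto simp: S_def intro!: bdd_belowI[of _ c])
  moreover have "closed S"
    unfolding S_def using continuous_on_stop_loss[OF x] continuous_on_stop_loss[OF y]
    by (intro closed_Collect_conj closed_Collect_le closed_Collect_eq) auto
  ultimately have h: "Inf S \<in> S" by (intro closed_contains_Inf)
  define h where "h = Inf S"
  have hS: "c < h" "stop_loss M x h = stop_loss M y h"
  proof -
    have "c \<le> h" "stop_loss M x h = stop_loss M y h" using h unfolding h_def S_def by blast+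
    then show "c < h" "stop_loss M x h = stop_loss M y h" using gap by (cases "c = h"; simp)+
  qed
  have below: "s \<notin> S" if "s < h" for s
    using cInf_lower[OF _ bdd, of s] that by (auto simp: h_def)
  have "AE \<omega> in M. \<forall>n. c \<le> x \<omega> \<and> x \<omega> \<le> h - (h - c) / (real n + 1) \<longrightarrow> x \<omega> = c"
  proof (subst AE_all_countable, intro allI gapI)
    fix n
    have "(h - c) * 1 \<le> (h - c) * (real n + 1)" using hS by (intro mult_left_mono) auto
    then have "0 < (h - c) / (real n + 1)" "(h - c) / (real n + 1) \<le> h - c"
      using hS by (simp_all add: divide_le_eq)
    then show "c \<le> h - (h - c) / (real n + 1)"
      "\<And>s. s \<le> h - (h - c) / (real n + 1) \<Longrightarrow> s \<notin> S" using below by auto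
  qed
  then have "AE \<omega> in M. x \<omega> > c \<longrightarrow> h \<le> x \<omega>"
  proof eventually_elim
    case (elim \<omega>)
    show ?case
    proof (intro impI, rule ccontr)
      assume a: "x \<omega> > c" "\<not> h \<le> x \<omega>"
      obtain n where n: "(h - c) / (h - x \<omega>) < real n" using reals_Archimedean2 by blast
      have "h - c < real n * (h - x \<omega>)" using n a by (simp add: field_simps)
      also have "\<dots> \<le> (real n + 1) * (h - x \<omega>)" using a by (intro mult_right_mono) auto
      finally have "(h - c) / (real n + 1) \<le> h - x \<omega>" by (simp add: field_simps)
      then show False using elim[rule_format, of n] a by auto
    qed
  qed
  with AE_space have "AE \<omega> in M. (\<omega> \<in> {\<omega>\<in>space M. x \<omega> > c} \<longrightarrow> h \<le> x \<omega>)
      \<and> (\<omega> \<notin> {\<omega>\<in>space M. x \<omega> > c} \<longrightarrow> x \<omega> \<le> h)"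
    by eventually_elim (use hS in auto)
  then show ?thesis
    unfolding r_def by (intro head_integral_eq_of_touching[OF x y maj _ _ hS(2)]) auto
qed

text \<open>
  The mirror image, with the nearest contact point below \<open>c\<close>.
\<close>

lemma extreme_point_head_integral_ge:
  assumes ext: "ae_extreme_point_of M x (Omega M y)" and y: "integrable M y"
    and gap: "stop_loss M x c < stop_loss M y c"
    and pos: "0 < prob {\<omega>\<in>space M. x \<omega> = c}"
  defines "r \<equiv> prob {\<omega>\<in>space M. x \<omega> \<ge> c}"
  shows "head_integral M x r = head_integral M y r"
proof -
  have x: "integrable M x" and maj: "majorised_by M x y"
    using ext by (auto simp: ae_extreme_point_of_def Omega_def)
  then have [measurable]: "x \<in> borel_measurable M" by auto
  have le: "stop_loss M x s \<le> stop_loss M y s" for s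
    using maj x y by (simp add: majorised_by_iff_stop_loss)
  show ?thesis
  proof (cases "r = 1")
    case True
    then show ?thesis using maj by (simp add: majorised_by_iff_head_integral)
  next
    case False
    define S where "S = {s. s \<le> c \<and> stop_loss M x s = stop_loss M y s}"
    have gapI: "AE \<omega> in M. q \<le> x \<omega> \<and> x \<omega> \<le> c \<longrightarrow> x \<omega> = c"
      if "q \<le> c" "\<And>s. s \<le> c \<Longrightarrow> q \<le> s \<Longrightarrow> s \<notin> S" for q
    proof (rule AE_not_between_stop_loss_gap[OF ext y _ that(1) order_refl pos])
      show "stop_loss M x s < stop_loss M y s" if "q \<le> s" "s \<le> c" for s
        using \<open>\<And>s. s \<le> c \<Longrightarrow> q \<le> s \<Longrightarrow> s \<notin> S\<close>[OF that(2,1)] that(2) le[of s]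
        unfolding S_def by fastforce
    qed
    have "S \<noteq> {}"
    proof
      assume "S = {}"
      then have "AE \<omega> in M. \<forall>n. c - real n \<le> x \<omega> \<and> x \<omega> \<le> c \<longrightarrow> x \<omega> = c"
        by (subst AE_all_countable, intro allI gapI) auto
      with AE_space have "AE \<omega> in M. \<omega> \<in> {\<omega>\<in>space M. x \<omega> \<ge> c}"
      proof eventually_elim
        case (elim \<omega>)
        obtain n where "c - x \<omega> < real n" using reals_Archimedean2 by blast
        then show ?case using elim(1) elim(2)[rule_format, of n] by (cases "x \<omega> \<le> c") auto
      qed
      then have "r = 1" unfolding r_def by (subst prob_eq_1) auto
      then show False using False by simp
    qed
    moreover have bdd: "bdd_above S" by (auto simp: S_def intro!: bdd_aboveI[of _ c])
    moreover have "closed S"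
      unfolding S_def using continuous_on_stop_loss[OF x] continuous_on_stop_loss[OF y]
      by (intro closed_Collect_conj closed_Collect_le closed_Collect_eq) auto
    ultimately have l: "Sup S \<in> S" by (intro closed_contains_Sup)
    define l where "l = Sup S"
    have lS: "l < c" "stop_loss M x l = stop_loss M y l"
    proof -
      have "l \<le> c" "stop_loss M x l = stop_loss M y l" using l unfolding l_def S_def by blast+
      then show "l < c" "stop_loss M x l = stop_loss M y l" using gap by (cases "c = l"; simp)+
    qed
    have above: "s \<notin> S" if "l < s" for s
      using cSup_upper[OF _ bdd, of s] that by (auto simp: l_def)
    have "AE \<omega> in M. \<forall>n. l + (c - l) / (real n + 1) \<le> x \<omega> \<and> x \<omega> \<le> c \<longrightarrow> x \<omega> = c"
    proof (subst AE_all_countable, intro allI gapI)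
      fix n
      have "(c - l) * 1 \<le> (c - l) * (real n + 1)" using lS by (intro mult_left_mono) auto
      then have "0 < (c - l) / (real n + 1)" "(c - l) / (real n + 1) \<le> c - l"
        using lS by (simp_all add: divide_le_eq)
      then show "l + (c - l) / (real n + 1) \<le> c"
        "\<And>s. l + (c - l) / (real n + 1) \<le> s \<Longrightarrow> s \<notin> S" using above by auto
    qed
    then have "AE \<omega> in M. x \<omega> < c \<longrightarrow> x \<omega> \<le> l"
    proof eventually_elim
      case (elim \<omega>)
      show ?case
      proof (intro impI, rule ccontr)
        assume a: "x \<omega> < c" "\<not> x \<omega> \<le> l"
        obtain n where n: "(c - l) / (x \<omega> - l) < real n" using reals_Archimedean2 by blast
        have "c - l < real n * (x \<omega> - l)" using n a by (simp add: field_simps)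
        also have "\<dots> \<le> (real n + 1) * (x \<omega> - l)" using a by (intro mult_right_mono) auto
        finally have "(c - l) / (real n + 1) \<le> x \<omega> - l" by (simp add: field_simps)
        then show False using elim[rule_format, of n] a by auto
      qed
    qed
    with AE_space have "AE \<omega> in M. (\<omega> \<in> {\<omega>\<in>space M. x \<omega> \<ge> c} \<longrightarrow> l \<le> x \<omega>)
        \<and> (\<omega> \<notin> {\<omega>\<in>space M. x \<omega> \<ge> c} \<longrightarrow> x \<omega> \<le> l)"
      by eventually_elim (use lS in auto)
    then show ?thesis
      unfolding r_def by (intro head_integral_eq_of_touching[OF x y maj _ _ lS(2)]) auto
  qed
qed

lemma extreme_point_imp_level_condition:
  assumes ext: "ae_extreme_point_of M x (Omega M y)" and y: "integrable M y"
    and t: "0 < t" "t < 1" and ne: "rearrangement M x t \<noteq> rearrangement M y t"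
  defines "c \<equiv> rearrangement M x t"
  shows "measure_atom M {\<omega>\<in>space M. x \<omega> = c}"
    and "(LBINT s:{s\<in>{0..<1}. rearrangement M x s = c}. rearrangement M y s)
      = c * prob {\<omega>\<in>space M. x \<omega> = c}"
proof -
  have x: "integrable M x" and maj: "majorised_by M x y"
    using ext by (auto simp: ae_extreme_point_of_def Omega_def)
  have gap: "stop_loss M x c < stop_loss M y c"
    unfolding c_def by (rule rearrangement_neq_imp_stop_loss_less[OF x y maj t ne])
  have pos: "0 < prob {\<omega>\<in>space M. x \<omega> = c}"
    using extreme_point_level_pos[OF ext y t] gap by (simp add: c_def)
  show "measure_atom M {\<omega>\<in>space M. x \<omega> = c}"
    by (rule extreme_point_level_atom[OF ext y gap pos])
  show "(LBINT s:{s\<in>{0..<1}. rearrangement M x s = c}. rearrangement M y s)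
      = c * prob {\<omega>\<in>space M. x \<omega> = c}"
    unfolding level_integral_eq_head_integral[OF x y]
    using extreme_point_head_integral_greater[OF ext y gap pos]
      extreme_point_head_integral_ge[OF ext y gap pos] head_integral_level_diff[OF x, of c]
    by simp
qed

section \<open>The level condition makes a point extreme\<close>

text \<open>
  The rearrangements differ only on level intervals of \<open>\<lambda>\<^sub>x\<close> whose level has positive measure under \<open>x\<close>. There
  are countably many of these, and on each the difference integrates to zero.
\<close>

lemma level_condition_imp_integral_eq:
  assumes x: "integrable M x" and y: "integrable M y"
    and lev: "\<And>t. 0 < t \<Longrightarrow> t < 1 \<Longrightarrow> rearrangement M x t \<noteq> rearrangement M y t \<Longrightarrow>
      0 < prob {\<omega>\<in>space M. x \<omega> = rearrangement M x t} \<and>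
      (LBINT s:{s\<in>{0..<1}. rearrangement M x s = rearrangement M x t}. rearrangement M y s)
        = rearrangement M x t * prob {\<omega>\<in>space M. x \<omega> = rearrangement M x t}"
    and Z: "Z \<in> sets borel"
  shows "(LINT t|unit_lborel. indicator Z (rearrangement M x t)
      * (rearrangement M y t - rearrangement M x t)) = 0"
proof -
  have xm: "x \<in> borel_measurable M" and ym: "y \<in> borel_measurable M" using x y by auto
  note [measurable] = xm rearrangement_measurable[OF xm] rearrangement_measurable[OF ym] Z
  let ?d = "\<lambda>t. rearrangement M y t - rearrangement M x t"
  define C where "C = {c\<in>Z. \<exists>t\<in>{0<..<1}. rearrangement M x t = c \<and> rearrangement M y t \<noteq> c}"
  have id: "integrable unit_lborel ?d"
    using integrable_rearrangement[OF x] integrable_rearrangement[OF y] by simp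
  have level: "(LINT t|unit_lborel. indicator {c} (rearrangement M x t) * ?d t) = 0" if c: "c \<in> C" for c
  proof -
    from c obtain t where t: "0 < t" "t < 1" "rearrangement M x t = c" "rearrangement M y t \<noteq> c"
      by (auto simp: C_def)
    have i: "integrable unit_lborel (\<lambda>t. indicator {c} (rearrangement M x t) * rearrangement M f t)"
      if f: "integrable M f" for f
    proof -
      note [measurable] = rearrangement_measurable[OF borel_measurable_integrable[OF f]]
      show ?thesis
        by (rule Bochner_Integration.integrable_bound[OF integrable_rearrangement[OF f]])
          (auto simp: indicator_def)
    qed
    have "(LINT t|unit_lborel. indicator {c} (rearrangement M x t) * ?d t)
        = (LINT t|unit_lborel. indicator {c} (rearrangement M x t) * rearrangement M y t)
        - (LINT t|unit_lborel. indicator {c} (rearrangement M x t) * rearrangement M x t)"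
      using i[OF x] i[OF y] by (simp add: right_diff_distrib)
    also have "\<dots> = (LBINT s:{s\<in>{0..<1}. rearrangement M x s = c}. rearrangement M y s)
        - (LBINT s:{s\<in>{0..<1}. rearrangement M x s = c}. rearrangement M x s)"
      by (simp only: level_integral_eq_unit_lborel[OF xm rearrangement_measurable[OF xm]]
          level_integral_eq_unit_lborel[OF xm rearrangement_measurable[OF ym]])
    also have "\<dots> = 0"
      unfolding level_integral_eq_head_integral[OF x x]
      using lev[OF t(1,2)] t head_integral_level_diff[OF x, of c] by simp
    finally show ?thesis .
  qed
  have "countable C"
  proof (rule countable_subset)
    interpret D: real_distribution "distr M borel x" by (simp add: real_distribution_distr)
    show "countable {c. measure (distr M borel x) {c} > 0}" by (rule D.countable_atoms)
    show "C \<subseteq> {c. measure (distr M borel x) {c} > 0}"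
      using lev by (force simp: C_def measure_distr vimage_def Int_def conj_commute)
  qed
  \<comment> \<open>An enumeration of the exceptional levels turns them into a sequence of disjoint sets; numbers
      that enumerate no level give the empty set.\<close>
  define A where "A n = {t\<in>{0<..<1}. rearrangement M x t \<in> C \<and> to_nat_on C (rearrangement M x t) = n}"
    for n :: nat
  have An: "(\<exists>c\<in>C. A n = {t\<in>space unit_lborel. rearrangement M x t = c}) \<or> A n = {}" for n
  proof (cases "\<exists>c\<in>C. to_nat_on C c = n")
    case True
    then obtain c where c: "c \<in> C" "to_nat_on C c = n" by blast
    have "rearrangement M x t \<in> C \<and> to_nat_on C (rearrangement M x t) = n
        \<longleftrightarrow> rearrangement M x t = c" for t
      using c inj_on_to_nat_on[OF \<open>countable C\<close>] by (metis inj_onD)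
    then have "A n = {t\<in>space unit_lborel. rearrangement M x t = c}"
      by (auto simp: A_def space_restrict_space)
    then show ?thesis using c by blast
  qed (auto simp: A_def)
  have AnM: "A n \<in> sets unit_lborel" for n
    using An[of n]
  proof
    assume "\<exists>c\<in>C. A n = {t\<in>space unit_lborel. rearrangement M x t = c}"
    then obtain c where c: "A n = {t\<in>space unit_lborel. rearrangement M x t = c}" by blast
    show ?thesis unfolding c by measurable
  qed simp
  have AnI: "(LINT t:A n|unit_lborel. ?d t) = 0" for n
    using An[of n]
  proof
    assume "\<exists>c\<in>C. A n = {t\<in>space unit_lborel. rearrangement M x t = c}"
    then obtain c where c: "c \<in> C" "A n = {t\<in>space unit_lborel. rearrangement M x t = c}"
      by blast
    have "(LINT t:A n|unit_lborel. ?d t)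
        = (LINT t|unit_lborel. indicator {c} (rearrangement M x t) * ?d t)"
      unfolding set_lebesgue_integral_def using c
      by (intro Bochner_Integration.integral_cong) (auto simp: indicator_def)
    then show ?thesis using level[OF c(1)] by simp
  qed (simp add: set_lebesgue_integral_def)
  have UA: "(\<Union>n. A n) = {t\<in>{0<..<1}. rearrangement M x t \<in> C}" by (auto simp: A_def)
  have UAM: "(\<Union>n. A n) \<in> sets unit_lborel" using AnM by auto
  have "(LINT t:(\<Union>n. A n)|unit_lborel. ?d t) = (\<Sum>n. LINT t:A n|unit_lborel. ?d t)"
  proof (rule lebesgue_integral_countable_add)
    show "A n \<in> sets unit_lborel" for n by (rule AnM)
    show "i \<noteq> j \<Longrightarrow> A i \<inter> A j = {}" for i j by (auto simp: A_def)
    show "set_integrable unit_lborel (\<Union>n. A n) ?d"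
      unfolding set_integrable_def using UAM id by (intro integrable_mult_indicator)
  qed
  also have "\<dots> = 0" by (simp add: AnI)
  also have "(LINT t:(\<Union>n. A n)|unit_lborel. ?d t)
      = (LINT t|unit_lborel. indicator Z (rearrangement M x t) * ?d t)"
    unfolding set_lebesgue_integral_def UA
    by (intro Bochner_Integration.integral_cong) (auto simp: indicator_def C_def space_restrict_space)
  finally show ?thesis .
qed

lemma head_integral_diff_rearrangement:
  assumes x: "integrable M x" and y: "integrable M y"
  shows "head_integral M y r - head_integral M x r
    = (LINT t|unit_lborel. indicator {..<r} t * (rearrangement M y t - rearrangement M x t))"
proof -
  have i: "integrable unit_lborel (\<lambda>t. indicator {..<r} t * rearrangement M f t)"
    if "integrable M f" for f
    using integrable_indicator_rearrangement[OF that, of "{..<r}" 0] by simp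
  show ?thesis
    using i[OF x] i[OF y] by (simp add: head_integral_def right_diff_distrib)
qed

lemma level_condition_imp_head_integral_eq:
  assumes x: "integrable M x" and y: "integrable M y"
    and lev: "\<And>t. 0 < t \<Longrightarrow> t < 1 \<Longrightarrow> rearrangement M x t \<noteq> rearrangement M y t \<Longrightarrow>
      0 < prob {\<omega>\<in>space M. x \<omega> = rearrangement M x t} \<and>
      (LBINT s:{s\<in>{0..<1}. rearrangement M x s = rearrangement M x t}. rearrangement M y s)
        = rearrangement M x t * prob {\<omega>\<in>space M. x \<omega> = rearrangement M x t}"
    and U: "U = {\<omega>\<in>space M. x \<omega> > c} \<or> U = {\<omega>\<in>space M. x \<omega> \<ge> c}"
  shows "head_integral M x (prob U) = head_integral M y (prob U)"
proof -
  have xm: "x \<in> borel_measurable M" and ym: "y \<in> borel_measurable M" using x y by auto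
  note [measurable] = rearrangement_measurable[OF xm] rearrangement_measurable[OF ym]
  obtain Z where Z: "Z \<in> sets borel" "AE t in unit_lborel. rearrangement M x t \<in> Z \<longleftrightarrow> t < prob U"
  proof -
    from U show thesis
    proof
      assume "U = {\<omega>\<in>space M. x \<omega> > c}"
      then show thesis
        using AE_rearrangement_greater_iff[OF xm, of c] by (intro that[of "{c<..}"]) auto
    next
      assume "U = {\<omega>\<in>space M. x \<omega> \<ge> c}"
      then show thesis
        using AE_rearrangement_ge_iff[OF xm, of c] by (intro that[of "{c..}"]) auto
    qed
  qed
  note [measurable] = Z(1)
  have "AE t in unit_lborel. indicator {..<prob U} t * (rearrangement M y t - rearrangement M x t)
      = indicator Z (rearrangement M x t) * (rearrangement M y t - rearrangement M x t)"
    using Z(2) by eventually_elim (auto simp: indicator_def)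
  then have "head_integral M y (prob U) - head_integral M x (prob U)
      = (LINT t|unit_lborel. indicator Z (rearrangement M x t)
          * (rearrangement M y t - rearrangement M x t))"
    unfolding head_integral_diff_rearrangement[OF x y]
    using integrable_indicator_rearrangement[OF x, of "{..<prob U}" 0]
      integrable_indicator_rearrangement[OF y, of "{..<prob U}" 0]
    by (intro integral_cong_AE) (auto simp: right_diff_distrib)
  also have "\<dots> = 0"
    by (rule level_condition_imp_integral_eq[OF x y _ Z(1)]) (rule lev)
  finally show ?thesis by simp
qed

text \<open>
  A converse to \<open>head_integral_eq_of_touching\<close>: where the two head integrals meet at a cut of \<open>x\<close>, the slope
  of \<open>F\<^sub>y\<close> is a contact point and separates the values of \<open>x\<close>.
\<close>

lemma touching_of_head_integral_eq:
  fixes x :: "'a \<Rightarrow> real"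
  assumes x: "integrable M x" and y: "integrable M y" and maj: "majorised_by M x y"
    and U: "U = {\<omega>\<in>space M. x \<omega> > c} \<or> U = {\<omega>\<in>space M. x \<omega> \<ge> c}"
    and r: "0 < prob U" "prob U < 1"
    and eq: "head_integral M x (prob U) = head_integral M y (prob U)"
  defines "s \<equiv> rearrangement M y (prob U)"
  shows "stop_loss M x s = stop_loss M y s"
    and "AE \<omega> in M. (\<omega> \<in> U \<longrightarrow> s \<le> x \<omega>) \<and> (\<omega> \<notin> U \<longrightarrow> x \<omega> \<le> s)"
proof -
  note [measurable] = borel_measurable_integrable[OF x]
  have UM: "U \<in> events" using U by auto
  have "stop_loss M y s = head_integral M y (prob U) - s * prob U"
    unfolding s_def by (rule head_integral_eq_stop_loss_rearrangement[OF y r, symmetric])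
  also have "\<dots> = (LINT \<omega>|M. indicator U \<omega> * x \<omega>) - s * prob U"
    using integral_upper_level_eq[OF x U] eq by simp
  finally have *: "stop_loss M y s = (LINT \<omega>|M. indicator U \<omega> * x \<omega>) - s * prob U" .
  moreover have "stop_loss M x s \<le> stop_loss M y s"
    using maj x y by (simp add: majorised_by_iff_stop_loss)
  ultimately show eq': "stop_loss M x s = stop_loss M y s"
    using integral_excess_le_stop_loss[OF x UM, of s] by linarith
  show "AE \<omega> in M. (\<omega> \<in> U \<longrightarrow> s \<le> x \<omega>) \<and> (\<omega> \<notin> U \<longrightarrow> x \<omega> \<le> s)"
    using * eq' by (intro integral_excess_eq_stop_lossD[OF x UM]) simp
qed

text \<open>
  The positive part is convex, and strictly so along segments that cross zero. At a contact
  point the convexity estimate for \<open>\<Phi>\<^sub>x(s)\<close> has no room, so almost no segment from \<open>a\<close> to \<open>b\<close> crosses \<open>s\<close>.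
\<close>

lemma segment_same_side:
  assumes y: "integrable M y" and x: "integrable M x"
    and a: "a \<in> Omega M y" and b: "b \<in> Omega M y"
    and u: "0 < u" "u < 1" and seg: "AE \<omega> in M. x \<omega> = (1 - u) * a \<omega> + u * b \<omega>"
    and eq: "stop_loss M x s = stop_loss M y s"
  shows "AE \<omega> in M. a \<omega> \<le> s \<and> b \<omega> \<le> s \<or> s \<le> a \<omega> \<and> s \<le> b \<omega>"
proof -
  have ai: "integrable M a" and bi: "integrable M b" using a b by (auto simp: Omega_def)
  have le: "stop_loss M a s \<le> stop_loss M y s" "stop_loss M b s \<le> stop_loss M y s"
    using a b ai bi y by (auto simp: Omega_def majorised_by_iff_stop_loss)
  let ?d = "\<lambda>\<omega>. (1 - u) * max 0 (a \<omega> - s) + u * max 0 (b \<omega> - s) - max 0 (x \<omega> - s)"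
  have id: "integrable M ?d"
    by (intro Bochner_Integration.integrable_diff Bochner_Integration.integrable_add
        integrable_mult_right integrable_stop_loss ai bi x)
  have nonneg: "AE \<omega> in M. 0 \<le> ?d \<omega>"
    using seg
  proof eventually_elim
    case (elim \<omega>)
    have "(1 - u) * (a \<omega> - s) \<le> (1 - u) * max 0 (a \<omega> - s)"
      "u * (b \<omega> - s) \<le> u * max 0 (b \<omega> - s)"
      "0 \<le> (1 - u) * max 0 (a \<omega> - s)" "0 \<le> u * max 0 (b \<omega> - s)"
      using u by (auto intro!: mult_left_mono mult_nonneg_nonneg)
    moreover have "x \<omega> - s = (1 - u) * (a \<omega> - s) + u * (b \<omega> - s)"
      using elim by (simp add: algebra_simps)
    ultimately show ?case by (simp add: max_def)
  qed
  have "(LINT \<omega>|M. ?d \<omega>) = (1 - u) * stop_loss M a s + u * stop_loss M b s - stop_loss M x s"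
    using integrable_stop_loss[OF ai, of s] integrable_stop_loss[OF bi, of s]
      integrable_stop_loss[OF x, of s]
    by (simp add: stop_loss_def)
  also have "\<dots> \<le> (1 - u) * stop_loss M y s + u * stop_loss M y s - stop_loss M y s"
    using u le eq by (intro diff_mono add_mono mult_left_mono) auto
  also have "\<dots> = 0" by (simp add: algebra_simps)
  finally have "(LINT \<omega>|M. ?d \<omega>) = 0"
    using integral_nonneg_AE[OF nonneg] by simp
  then have "AE \<omega> in M. ?d \<omega> = 0"
    using integral_nonneg_eq_0_iff_AE[OF id nonneg] by simp
  with seg show ?thesis
  proof eventually_elim
    case (elim \<omega>)
    have xs: "x \<omega> - s = (1 - u) * (a \<omega> - s) + u * (b \<omega> - s)"
      using elim by (simp add: algebra_simps)
    have no: "\<not> (v < 0 \<and> 0 < w)"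
      if "0 < k" "0 < l" "k * max 0 v + l * max 0 w = max 0 (k * v + l * w)" for k l v w :: real
    proof
      assume vw: "v < 0 \<and> 0 < w"
      then have "0 < l * w" "k * v < 0" using that by (auto simp: mult_pos_neg)
      then show False using that vw by (auto simp: max_def split: if_splits)
    qed
    have "(1 - u) * max 0 (a \<omega> - s) + u * max 0 (b \<omega> - s)
        = max 0 ((1 - u) * (a \<omega> - s) + u * (b \<omega> - s))"
      using elim xs by simp
    then show ?case
      using no[of "1 - u" u "a \<omega> - s" "b \<omega> - s"] no[of u "1 - u" "b \<omega> - s" "a \<omega> - s"] u
      by (auto simp: add.commute)
  qed
qed

text \<open>
  On \<open>U\<close> the integrals of \<open>a\<close> and \<open>b\<close> are at most \<open>F\<^sub>y(prob U)\<close> by the Hardy-Littlewood inequality, which is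
  the integral of \<open>x\<close>, their convex combination. So both attain the bound.
\<close>

lemma segment_upper_level_integral_eq:
  fixes x :: "'a \<Rightarrow> real"
  assumes y: "integrable M y" and x: "integrable M x"
    and a: "a \<in> Omega M y" and b: "b \<in> Omega M y"
    and u: "0 < u" "u < 1" and seg: "AE \<omega> in M. x \<omega> = (1 - u) * a \<omega> + u * b \<omega>"
    and U: "U = {\<omega>\<in>space M. x \<omega> > c} \<or> U = {\<omega>\<in>space M. x \<omega> \<ge> c}"
    and eq: "head_integral M x (prob U) = head_integral M y (prob U)"
  shows "(LINT \<omega>|M. indicator U \<omega> * a \<omega>) = (LINT \<omega>|M. indicator U \<omega> * b \<omega>)"
proof -
  note [measurable] = borel_measurable_integrable[OF x]
  have UM: "U \<in> events" using U by auto
  have ai: "integrable M a" and bi: "integrable M b"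
    and maj: "majorised_by M a y" "majorised_by M b y" using a b by (auto simp: Omega_def)
  note [measurable] = borel_measurable_integrable[OF ai] borel_measurable_integrable[OF bi] UM
  let ?I = "\<lambda>f. LINT \<omega>|M. indicator U \<omega> * f \<omega>"
  have le: "?I f \<le> ?I x" if f: "integrable M f" "majorised_by M f y" for f
    using integral_le_head_integral[OF f(1) UM] head_integral_mono_majorised[OF f(1) y f(2), of "prob U"]
      integral_upper_level_eq[OF x U] eq by simp
  have i: "integrable M (\<lambda>\<omega>. indicator U \<omega> * f \<omega>)" if "integrable M f" for f :: "'a \<Rightarrow> real"
    using integrable_real_mult_indicator[OF UM that] by (simp add: mult.commute)
  have "AE \<omega> in M. indicator U \<omega> * x \<omega>
      = (1 - u) * (indicator U \<omega> * a \<omega>) + u * (indicator U \<omega> * b \<omega>)"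
    using seg
  proof eventually_elim
    case (elim \<omega>)
    then show ?case by (cases "\<omega> \<in> U") auto
  qed
  then have "?I x = (LINT \<omega>|M. (1 - u) * (indicator U \<omega> * a \<omega>) + u * (indicator U \<omega> * b \<omega>))"
    by (intro integral_cong_AE) auto
  also have "\<dots> = (1 - u) * ?I a + u * ?I b"
    using i[OF ai] i[OF bi] by simp
  finally have "(1 - u) * (?I x - ?I a) + u * (?I x - ?I b) = 0"
    by (simp add: algebra_simps)
  moreover have "0 \<le> (1 - u) * (?I x - ?I a)" "0 \<le> u * (?I x - ?I b)"
    using le[OF ai maj(1)] le[OF bi maj(2)] u by auto
  ultimately have "(1 - u) * (?I x - ?I a) = 0" "u * (?I x - ?I b) = 0" by linarith+
  then show ?thesis using u by simp
qed

text \<open>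
  A crossing at \<open>p\<close> on a set \<open>D\<close> of positive measure makes \<open>p\<close> a point without contact. The cut
  \<open>r\<close> at which \<open>F\<^sub>y\<close> attains \<open>\<Phi>\<^sub>y(p)\<close> then lies strictly inside a level interval of \<open>\<lambda>\<^sub>x\<close>, with level \<open>c\<close>. The
  slopes \<open>h\<close> and \<open>l\<close> of \<open>F\<^sub>y\<close> at the ends of this interval are contact points on either side of \<open>p\<close>; they
  keep \<open>x\<close> on \<open>D\<close> strictly between \<open>l\<close> and \<open>h\<close>, where it has only the value \<open>c\<close> to take. At an end of the
  interval that is 0 or 1 there is nothing to show, as \<open>x\<close> has almost no values beyond \<open>c\<close> on that side.
\<close>

lemma segment_no_crossing:
  assumes y: "integrable M y" and x: "integrable M x" and maj: "majorised_by M x y"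
    and lev: "\<And>t. 0 < t \<Longrightarrow> t < 1 \<Longrightarrow> rearrangement M x t \<noteq> rearrangement M y t \<Longrightarrow>
      measure_atom M {\<omega>\<in>space M. x \<omega> = rearrangement M x t} \<and>
      (LBINT s:{s\<in>{0..<1}. rearrangement M x s = rearrangement M x t}. rearrangement M y s)
        = rearrangement M x t * prob {\<omega>\<in>space M. x \<omega> = rearrangement M x t}"
    and a: "a \<in> Omega M y" and b: "b \<in> Omega M y"
    and u: "0 < u" "u < 1" and seg: "AE \<omega> in M. x \<omega> = (1 - u) * a \<omega> + u * b \<omega>"
  shows "AE \<omega> in M. \<not> (a \<omega> < p \<and> p < b \<omega>)"
proof (rule ccontr)
  assume n: "\<not> ?thesis"
  have ai: "integrable M a" and bi: "integrable M b" using a b by (auto simp: Omega_def)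
  have xm: "x \<in> borel_measurable M" and ym: "y \<in> borel_measurable M" using x y by auto
  note [measurable] = borel_measurable_integrable[OF ai] borel_measurable_integrable[OF bi] xm ym
  note same_side = segment_same_side[OF y x a b u seg]
  let ?F = "head_integral M x" and ?G = "head_integral M y"
  have lev': "0 < prob {\<omega>\<in>space M. x \<omega> = rearrangement M x t} \<and>
      (LBINT s:{s\<in>{0..<1}. rearrangement M x s = rearrangement M x t}. rearrangement M y s)
        = rearrangement M x t * prob {\<omega>\<in>space M. x \<omega> = rearrangement M x t}"
    if "0 < t" "t < 1" "rearrangement M x t \<noteq> rearrangement M y t" for t
    using lev[OF that] by (auto simp: measure_atom_def emeasure_eq_measure)
  have gap: "stop_loss M x p \<noteq> stop_loss M y p"
  proof
    assume "stop_loss M x p = stop_loss M y p"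
    from same_side[OF this] have "AE \<omega> in M. \<not> (a \<omega> < p \<and> p < b \<omega>)" by eventually_elim auto
    with n show False by contradiction
  qed
  define r where "r = prob {\<omega>\<in>space M. y \<omega> > p}"
  have FGr: "?F r \<noteq> ?G r"
  proof
    assume "?F r = ?G r"
    moreover have "?G r - p * r = stop_loss M y p"
      using prob_greater_le_ge[OF ym, of p] unfolding r_def
      by (intro head_integral_eq_stop_loss_level y) auto
    moreover have "?F r - p * r \<le> stop_loss M x p"
      unfolding r_def by (intro head_integral_le_stop_loss x) auto
    moreover have "stop_loss M x p \<le> stop_loss M y p"
      using maj x y by (simp add: majorised_by_iff_stop_loss)
    ultimately show False using gap by simp
  qed
  have "r \<noteq> 0" "r \<noteq> 1"
    using FGr maj by (auto simp: head_integral_0 majorised_by_iff_head_integral)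
  then have r: "0 < r" "r < 1" using prob_le_1 by (auto simp: r_def less_le)
  define c where "c = rearrangement M x r"
  define U V A where "U = {\<omega>\<in>space M. x \<omega> > c}" and "V = {\<omega>\<in>space M. x \<omega> \<ge> c}"
    and "A = {\<omega>\<in>space M. x \<omega> = c}"
  have [measurable]: "U \<in> events" "V \<in> events" "A \<in> events"
    by (auto simp: U_def V_def A_def)
  have FGU: "?F (prob U) = ?G (prob U)" and FGV: "?F (prob V) = ?G (prob V)"
    by (rule level_condition_imp_head_integral_eq[OF x y lev'];
        auto simp: U_def V_def)+
  have "prob U \<le> r"
    using rearrangement_le_iff[OF xm r, of c] by (simp add: c_def U_def)
  moreover have "r \<le> prob V"
    using rearrangement_less[OF xm, of c r] r by (force simp: c_def V_def)
  ultimately have UV: "prob U < r" "r < prob V"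
    using FGr FGU FGV by (auto simp: less_le)
  \<comment> \<open>If the rearrangements agreed on the level interval, the equality of the head integrals at its
      left end would persist up to \<open>r\<close>.\<close>
  have "\<exists>t. 0 < t \<and> t < 1 \<and> rearrangement M x t = c \<and> rearrangement M y t \<noteq> c"
  proof (rule ccontr)
    assume "\<not> ?thesis"
    then have c: "rearrangement M y t = c" if "0 < t" "t < 1" "rearrangement M x t = c" for t
      using that by blast
    have "rearrangement M x t = c" if "prob U \<le> t" "t < r" "0 < t" for t
      using that r UV rearrangement_le_iff[OF xm, of t c] le_rearrangement[OF xm, of t c]
      by (intro order_antisym) (auto simp: U_def V_def)
    then have "?G r - ?F r = ?G (prob U) - ?F (prob U)"
      unfolding head_integral_diff_rearrangement[OF x y] using r UV c
      by (intro Bochner_Integration.integral_cong)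
        (force simp: indicator_def space_restrict_space)+
    then show False using FGr FGU by simp
  qed
  then obtain t where t: "0 < t" "t < 1" "rearrangement M x t = c" "rearrangement M y t \<noteq> c"
    by blast
  have atom: "measure_atom M A" using lev[OF t(1,2)] t by (simp add: A_def)

  define D where "D = {\<omega>\<in>space M. a \<omega> < p \<and> p < b \<omega>}"
  have [measurable]: "D \<in> events" unfolding D_def by measurable
  have "AE \<omega> in M. \<omega> \<in> D \<longrightarrow> x \<omega> \<le> c"
  proof (cases "prob U = 0")
    case True
    then have "AE \<omega> in M. \<omega> \<notin> U" by (subst (asm) prob_eq_0) auto
    with AE_space show ?thesis by eventually_elim (auto simp: U_def)
  next
    case False
    then have U01: "0 < prob U" "prob U < 1" using UV r by (auto simp: zero_less_measure_iff)
    define h where "h = rearrangement M y (prob U)"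
    have h: "p < h"
      using less_rearrangement_iff[OF ym U01, of p] UV by (simp add: h_def r_def)
    have U': "U = {\<omega>\<in>space M. x \<omega> > c} \<or> U = {\<omega>\<in>space M. x \<omega> \<ge> c}" by (simp add: U_def)
    note touch = touching_of_head_integral_eq[OF x y maj U' U01 FGU, folded h_def]
    show ?thesis
      using same_side[OF touch(1)] touch(2) seg AE_space
    proof eventually_elim
      case (elim \<omega>)
      show ?case
      proof
        assume D: "\<omega> \<in> D"
        then have "a \<omega> < h" "b \<omega> \<le> h" using elim h by (auto simp: D_def)
        then have "(1 - u) * a \<omega> + u * b \<omega> < (1 - u) * h + u * h"
          using u by (intro add_less_le_mono mult_strict_left_mono mult_left_mono) auto
        then have "x \<omega> < h" using elim by (simp add: algebra_simps)
        then show "x \<omega> \<le> c" using elim by (auto simp: U_def not_less)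
      qed
    qed
  qed
  moreover have "AE \<omega> in M. \<omega> \<in> D \<longrightarrow> c \<le> x \<omega>"
  proof (cases "prob V = 1")
    case True
    then have "AE \<omega> in M. \<omega> \<in> V" by (subst (asm) prob_eq_1) auto
    then show ?thesis by eventually_elim (auto simp: V_def)
  next
    case False
    then have V01: "0 < prob V" "prob V < 1" using UV r prob_le_1[of V] by linarith+
    define l where "l = rearrangement M y (prob V)"
    have V': "V = {\<omega>\<in>space M. x \<omega> > c} \<or> V = {\<omega>\<in>space M. x \<omega> \<ge> c}" by (simp add: V_def)
    note touch = touching_of_head_integral_eq[OF x y maj V' V01 FGV, folded l_def]
    have "l \<le> p"
      using rearrangement_le_iff[OF ym V01, of p] UV by (simp add: l_def r_def)
    then have l: "l < p" using touch(1) gap by (cases "l = p") auto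
    show ?thesis
      using same_side[OF touch(1)] touch(2) seg AE_space
    proof eventually_elim
      case (elim \<omega>)
      show ?case
      proof
        assume D: "\<omega> \<in> D"
        then have "l \<le> a \<omega>" "l < b \<omega>" using elim l by (auto simp: D_def)
        then have "(1 - u) * l + u * l < (1 - u) * a \<omega> + u * b \<omega>"
          using u by (intro add_le_less_mono mult_strict_left_mono mult_left_mono) auto
        then have "l < x \<omega>" using elim by (simp add: algebra_simps)
        then show "c \<le> x \<omega>" using elim by (auto simp: V_def)
      qed
    qed
  qed
  ultimately have DA: "AE \<omega> in M. \<omega> \<in> D \<longrightarrow> \<omega> \<in> A"
    using AE_space by eventually_elim (auto simp: A_def)
  \<comment> \<open>Up to a null set \<open>D\<close> is a part of the atom \<open>A\<close>, hence all of it. So \<open>a < p < b\<close> on \<open>A\<close>, while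
      the integrals over \<open>A = V - U\<close> agree.\<close>
  have "prob (D \<inter> A) \<noteq> 0"
  proof
    assume "prob (D \<inter> A) = 0"
    then have "AE \<omega> in M. \<omega> \<notin> D \<inter> A" by (subst (asm) prob_eq_0) auto
    with DA AE_space have "AE \<omega> in M. \<not> (a \<omega> < p \<and> p < b \<omega>)"
      by eventually_elim (auto simp: D_def)
    with n show False by contradiction
  qed
  then have "prob (D \<inter> A) = prob A"
    using atom by (auto simp: measure_atom_def emeasure_eq_measure dest!: bspec[of _ _ "D \<inter> A"])
  then have "prob (A - D) = 0"
    using finite_measure_Diff[of A "D \<inter> A"] by (simp add: Diff_Int)
  then have AD: "AE \<omega> in M. \<omega> \<notin> A - D" by (subst (asm) prob_eq_0) auto
  have i: "integrable M (\<lambda>\<omega>. indicator B \<omega> * f \<omega>)" if "integrable M f" "B \<in> events"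
    for f :: "'a \<Rightarrow> real" and B
    using integrable_real_mult_indicator[OF that(2,1)] by (simp add: mult.commute)
  have eqU: "(LINT \<omega>|M. indicator U \<omega> * a \<omega>) = (LINT \<omega>|M. indicator U \<omega> * b \<omega>)"
    by (rule segment_upper_level_integral_eq[where c = c, OF y x a b u seg _ FGU]) (simp add: U_def)
  have eqV: "(LINT \<omega>|M. indicator V \<omega> * a \<omega>) = (LINT \<omega>|M. indicator V \<omega> * b \<omega>)"
    by (rule segment_upper_level_integral_eq[where c = c, OF y x a b u seg _ FGV]) (simp add: V_def)
  have "(LINT \<omega>|M. indicator A \<omega> * (b \<omega> - a \<omega>))
      = (LINT \<omega>|M. (indicator V \<omega> * b \<omega> - indicator U \<omega> * b \<omega>)
          - (indicator V \<omega> * a \<omega> - indicator U \<omega> * a \<omega>))"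
    by (intro Bochner_Integration.integral_cong) (auto simp: indicator_def A_def U_def V_def)
  also have "\<dots> = 0"
    using i[OF ai] i[OF bi] eqU eqV by simp
  finally have int0: "(LINT \<omega>|M. indicator A \<omega> * (b \<omega> - a \<omega>)) = 0" .
  have nonneg: "AE \<omega> in M. 0 \<le> indicator A \<omega> * (b \<omega> - a \<omega>)"
    using AD by eventually_elim (auto simp: indicator_def D_def)
  have "integrable M (\<lambda>\<omega>. indicator A \<omega> * (b \<omega> - a \<omega>))"
    using ai bi by (intro i) auto
  from integral_nonneg_eq_0_iff_AE[OF this nonneg] int0
  have "AE \<omega> in M. indicator A \<omega> * (b \<omega> - a \<omega>) = 0" by simp
  with AD have "AE \<omega> in M. \<omega> \<notin> A" by eventually_elim (auto simp: indicator_def D_def)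
  then have "prob A = 0" by (subst prob_eq_0) auto
  then show False using atom by (simp add: measure_atom_def emeasure_eq_measure)
qed

text \<open>
  Two functions that cross no rational number coincide, and there are only countably many to exclude.
\<close>

lemma level_condition_imp_extreme_point:
  assumes y: "integrable M y" and x: "x \<in> Omega M y"
    and lev: "\<And>t. 0 < t \<Longrightarrow> t < 1 \<Longrightarrow> rearrangement M x t \<noteq> rearrangement M y t \<Longrightarrow>
      measure_atom M {\<omega>\<in>space M. x \<omega> = rearrangement M x t} \<and>
      (LBINT s:{s\<in>{0..<1}. rearrangement M x s = rearrangement M x t}. rearrangement M y s)
        = rearrangement M x t * prob {\<omega>\<in>space M. x \<omega> = rearrangement M x t}"
  shows "ae_extreme_point_of M x (Omega M y)"
proof -
  have xi: "integrable M x" and maj: "majorised_by M x y" using x by (auto simp: Omega_def)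
  have "AE \<omega> in M. a \<omega> = b \<omega>"
    if a: "a \<in> Omega M y" and b: "b \<in> Omega M y" and u: "0 < u" "u < 1"
      and seg: "AE \<omega> in M. x \<omega> = (1 - u) * a \<omega> + u * b \<omega>" for a b u
  proof -
    have u': "0 < 1 - u" "1 - u < 1" using u by auto
    have seg': "AE \<omega> in M. x \<omega> = (1 - (1 - u)) * b \<omega> + (1 - u) * a \<omega>"
      using seg by eventually_elim simp
    have "AE \<omega> in M. \<forall>p\<in>\<rat>. \<not> (a \<omega> < p \<and> p < b \<omega>)"
      by (subst AE_ball_countable[OF countable_rat], intro ballI,
          rule segment_no_crossing[OF y xi maj _ a b u seg]) (rule lev)
    moreover have "AE \<omega> in M. \<forall>p\<in>\<rat>. \<not> (b \<omega> < p \<and> p < a \<omega>)"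
      by (subst AE_ball_countable[OF countable_rat], intro ballI,
          rule segment_no_crossing[OF y xi maj _ b a u' seg']) (rule lev)
    ultimately show ?thesis
    proof eventually_elim
      case (elim \<omega>)
      then show ?case
        using Rats_dense_in_real[of "a \<omega>" "b \<omega>"] Rats_dense_in_real[of "b \<omega>" "a \<omega>"]
        by (metis less_linear)
    qed
  qed
  then show ?thesis using x unfolding ae_extreme_point_of_def by blast
qed

end

theorem corollary1p2:
  fixes M :: "'a measure" and x y :: "'a \<Rightarrow> real"
  assumes "prob_space M"
    and "integrable M y"
    and "x \<in> Omega M y"
  shows "ae_extreme_point_of M x (Omega M y) \<longleftrightarrow>
    (\<forall>t\<in>{0<..<1}.
       rearrangement M x t = rearrangement M y t \<or>
       (rearrangement M x t \<noteq> rearrangement M y t \<and>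
        measure_atom M (x -` {rearrangement M x t} \<inter> space M) \<and>
        (LBINT s:{s\<in>{0..<1}. rearrangement M x s = rearrangement M x t}. rearrangement M y s)
          = rearrangement M x t * measure M (x -` {rearrangement M x t} \<inter> space M)))"
proof -
  interpret prob_space M by fact
  have vimage: "x -` {c} \<inter> space M = {\<omega>\<in>space M. x \<omega> = c}" for c by auto
  show ?thesis
    unfolding vimage
  proof (intro iffI ballI)
    fix t :: real
    assume ext: "ae_extreme_point_of M x (Omega M y)" and t: "t \<in> {0<..<1}"
    then have t01: "0 < t" "t < 1" by auto
    show "rearrangement M x t = rearrangement M y t \<or>
       (rearrangement M x t \<noteq> rearrangement M y t \<and>
        measure_atom M {\<omega>\<in>space M. x \<omega> = rearrangement M x t} \<and>
        (LBINT s:{s\<in>{0..<1}. rearrangement M x s = rearrangement M x t}. rearrangement M y s)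
          = rearrangement M x t * prob {\<omega>\<in>space M. x \<omega> = rearrangement M x t})"
      using extreme_point_imp_level_condition[OF ext assms(2) t01] by blast
  next
    assume C: "\<forall>t\<in>{0<..<1}. rearrangement M x t = rearrangement M y t \<or>
       (rearrangement M x t \<noteq> rearrangement M y t \<and>
        measure_atom M {\<omega>\<in>space M. x \<omega> = rearrangement M x t} \<and>
        (LBINT s:{s\<in>{0..<1}. rearrangement M x s = rearrangement M x t}. rearrangement M y s)
          = rearrangement M x t * prob {\<omega>\<in>space M. x \<omega> = rearrangement M x t})"
    show "ae_extreme_point_of M x (Omega M y)"
    proof (rule level_condition_imp_extreme_point[OF assms(2,3)])
      fix t :: real
      assume "0 < t" "t < 1" "rearrangement M x t \<noteq> rearrangement M y t"
      then show "measure_atom M {\<omega>\<in>space M. x \<omega> = rearrangement M x t} \<and>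
        (LBINT s:{s\<in>{0..<1}. rearrangement M x s = rearrangement M x t}. rearrangement M y s)
          = rearrangement M x t * prob {\<omega>\<in>space M. x \<omega> = rearrangement M x t}"
        using C[rule_format, of t] by simp
    qed
  qed
qed
end
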